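(* Let $n,m\ge1$, let $\beta_1,\beta_2\in \mathrm{Br}_n^+$ and $\gamma\in\mathrm{Br}_m^+$ be positive braids, and put $N=n+m-1$. Write $\gamma=\sigma_{i_1}\cdots\sigma_{i_k}$ with $1\le i_j\le m-1$, and let $\tilde\gamma=\sigma_{i_1+n-1}\cdots\sigma_{i_k+n-1}\in\mathrm{Br}_N^+$ (the braid obtained from $\gamma$ by adding $n-1$ parallel strands at the bottom). Regard $\beta_1,\beta_2$ as elements of $\mathrm{Br}_N^+$ using the same generators $\sigma_1,\dots,\sigma_{n-1}$. Then the $\mathbb{Z}/2$-graded ruling polynomials of the rainbow closures satisfy $$R_{(\beta_1\tilde\gamma\beta_2)^{>}}(z)=z\,R_{\gamma^{>}}(z)\,R_{(\beta_1\beta_2)^{>}}(z),$$ where $(\beta_1\beta_2)^{>}$ is the rainbow closure of the $n$-strand braid $\beta_1\beta_2\in\mathrm{Br}_n^+$. In particular, if the coefficient sequences (in powers of $z^2$) of the normalized ruling polynomials $\widetilde R_{\gamma^{>}}(z)$ and $\widetilde R_{(\beta_1\beta_2)^{>}}(z)$ are both log-concave with no internal zeros, then so is the coefficient sequence of $\widetilde R_{(\beta_1\tilde\gamma\beta_2)^{>}}(z)$.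
   Context: $\mathrm{Br}_n^+$ denotes the monoid of positive braids on $n$ strands, generated by $\sigma_1,\dots,\sigma_{n-1}$; strands are labelled $1,\dots,n$ from bottom to top and braid words are read from left to right. The rainbow closure $\beta^{>}$ of $\beta\in\mathrm{Br}_n^+$ is the Legendrian link in standard contact $\mathbb{R}^3$ whose front diagram is $\beta$ closed up by $n$ nested arcs passing above $\beta$, with $n$ left cusps and $n$ right cusps. The $\mathbb{Z}/2$-graded ruling polynomial of a Legendrian link $\Lambda$ is $R_\Lambda(z)=\sum_\rho z^{|S(\rho)|-\#\{\text{right cusps}\}}$, the sum being over all $\mathbb{Z}/2$-graded normal rulings $\rho$ of the front of $\Lambda$, with $S(\rho)$ the set of switches of $\rho$. For rainbow closures it has the following combinatorial description. Let $\beta=\sigma_{i_1}\cdots\sigma_{i_\ell}\in\mathrm{Br}_n^+$, let $S_n$ be the symmetric group on $\{1,\dots,n\}$ with longest element $w_0$ ($w_0(i)=n+1-i$), and let $\mathrm{s}_k=(k\ \ k+1)$. A $w_0$-$w_0$-walk of $\beta$ is a sequence $p=(p_\ell,\dots,p_0)\in S_n^{\ell+1}$ with $p_0=p_\ell=w_0$ such that for each $1\le r\le\ell$: $p_r=\mathrm{s}_{i_r}p_{r-1}$ if $\mathrm{s}_{i_r}p_{r-1}>p_{r-1}$ in Bruhat order, and $p_r\in\{\mathrm{s}_{i_r}p_{r-1},\,p_{r-1}\}$ if $\mathrm{s}_{i_r}p_{r-1}<p_{r-1}$. Let $\mathcal{W}(\beta)$ be the set of such walks and $S_p=\{r\mid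 p_r=p_{r-1}\}$. Walks are in canonical bijection with the normal rulings of $\beta^{>}$ (strand $p_r(j)$ of the braid is paired, immediately after the $r$-th crossing, with the $j$-th lowest of the $n$ closing strands), with $S_p$ corresponding to the switches, so $$R_{\beta^{>}}(z)=\sum_{p\in\mathcal{W}(\beta)}z^{|S_p|-n}.$$ The normalized ruling polynomial is $\widetilde R_{\beta^{>}}(z)=z^{b}R_{\beta^{>}}(z)$, where $b$ is the number of connected components of $\beta^{>}$, i.e. the number of cycles (including $1$-cycles) of $\mathrm{s}_{i_\ell}\circ\cdots\circ\mathrm{s}_{i_1}$. It is known that $\widetilde R_{\beta^{>}}(z)\in\mathbb{Z}_{\ge0}[z^2]$. Writing $\widetilde R_{\beta^{>}}(z)=\sum_{j=0}^{\delta}a_jz^{2j}$ with $2\delta$ its degree, its coefficient sequence is $(a_0,\dots,a_\delta)$. A sequence $a_0,\dots,a_\delta$ of nonnegative reals is log-concave if $a_j^2\ge a_{j-1}a_{j+1}$ for all $1\le j\le\delta-1$; it has no internal zeros if there are no $i<j<k$ with $a_i,a_k>0$ and $a_j=0$. *)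

theory Defs
  imports
    "HOL-Combinatorics.Orbits"
    "HOL-Computational_Algebra.Formal_Laurent_Series"
begin

section \<open>Front diagrams and their graded normal rulings\<close>

text \<open>
  A generic front is recorded as the list of its singularities, read from left to right. Between
  two consecutive singularities the strands are numbered \<open>1, 2, \<dots>\<close> from bottom to top, and each
  singularity involves the two adjacent strands \<open>k\<close> and \<open>k + 1\<close>. The boolean at a left cusp is
  the Maslov potential modulo 2 of its lower strand; that of the upper strand is one more.
  Modulo 2, a Maslov potential is the same thing as an orientation of the link.
\<close>

datatype front_event = LCusp nat bool | Cross nat | RCusp nat

type_synonym front = "front_event list"

definition right_cusps :: "front \<Rightarrow> nat" where
  "right_cusps F = length (filter (\<lambda>e. \<exists>k. e = RCusp k) F)"

text \<open>
  The Maslov potentials modulo 2 of the strands between two singularities form a list, from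
  bottom to top; strand \<open>k\<close> is at list position \<open>k - 1\<close>, and the length of the list is the number
  of strands. \<open>slice F r\<close> is this list just after the first \<open>r\<close> singularities.
\<close>

fun pass :: "front_event \<Rightarrow> bool list \<Rightarrow> bool list" where
  "pass (LCusp k c) \<mu> = take (k - 1) \<mu> @ [c, \<not> c] @ drop (k - 1) \<mu>"
| "pass (Cross k) \<mu> = \<mu>[k - 1 := \<mu> ! k, k := \<mu> ! (k - 1)]"
| "pass (RCusp k) \<mu> = take (k - 1) \<mu> @ drop (k + 1) \<mu>"

definition slice :: "front \<Rightarrow> nat \<Rightarrow> bool list" where
  "slice F r = fold pass (take r F) []"

text \<open>
  \<open>ffp_involution s \<rho>\<close>: the pairing \<open>\<rho>\<close> is a fixed-point-free involution of the strands
  \<open>1, \<dots>, s\<close>. By \<open>permutes\<close> it is the identity elsewhere, so that each pairing is represented by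
  exactly one function.
\<close>

definition ffp_involution :: "nat \<Rightarrow> (nat \<Rightarrow> nat) \<Rightarrow> bool" where
  "ffp_involution s \<rho> \<longleftrightarrow>
     \<rho> permutes {1..s} \<and> (\<forall>i\<in>{1..s}. \<rho> (\<rho> i) = i \<and> \<rho> i \<noteq> i)"

text \<open>\<open>skip k\<close> renumbers the strands when two new ones are inserted at heights \<open>k\<close> and \<open>k + 1\<close>.\<close>

definition skip :: "nat \<Rightarrow> nat \<Rightarrow> nat" where
  "skip k i = (if i < k then i else i + 2)"

text \<open>The intersection of a vertical line with the ruling disk bounded by strand \<open>i\<close> and its companion.\<close>

definition disk :: "(nat \<Rightarrow> nat) \<Rightarrow> nat \<Rightarrow> nat set" where
  "disk \<rho> i = {min i (\<rho> i)..max i (\<rho> i)}"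

definition normal_at :: "nat \<Rightarrow> (nat \<Rightarrow> nat) \<Rightarrow> bool" where
  "normal_at k \<rho> \<longleftrightarrow>
     disk \<rho> k \<inter> disk \<rho> (k + 1) = {} \<or>
     disk \<rho> k \<subseteq> disk \<rho> (k + 1) \<or> disk \<rho> (k + 1) \<subseteq> disk \<rho> k"

text \<open>
  \<open>ruling_step e \<mu> \<rho> \<rho>'\<close>: the pairings \<open>\<rho>\<close> just before and \<open>\<rho>'\<close> just after the singularity \<open>e\<close> are
  compatible, \<open>\<mu>\<close> being the Maslov potential just before \<open>e\<close>. Companion strands meet only at cusps.
  At a crossing, either both ruling paths follow the strands of the front, or they switch strands;
  the latter requires a crossing of even degree and the normality condition.
\<close>

fun ruling_step ::
  "front_event \<Rightarrow> bool list \<Rightarrow> (nat \<Rightarrow> nat) \<Rightarrow> (nat \<Rightarrow> nat) \<Rightarrow> bool" where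
  "ruling_step (LCusp k c) \<mu> \<rho> \<rho>' \<longleftrightarrow> \<rho>' k = k + 1 \<and> \<rho>' \<circ> skip k = skip k \<circ> \<rho>"
| "ruling_step (Cross k) \<mu> \<rho> \<rho>' \<longleftrightarrow>
     \<rho> k \<noteq> k + 1 \<and>
     (\<rho>' = transpose k (k + 1) \<circ> \<rho> \<circ> transpose k (k + 1) \<or>
      \<rho>' = \<rho> \<and> \<mu> ! (k - 1) = \<mu> ! k \<and> normal_at k \<rho>)"
| "ruling_step (RCusp k) \<mu> \<rho> \<rho>' \<longleftrightarrow> \<rho> k = k + 1 \<and> \<rho> \<circ> skip k = skip k \<circ> \<rho>'"

text \<open>A ruling is the list of its pairings before, between and after the singularities.\<close>

definition graded_normal_rulings :: "front \<Rightarrow> (nat \<Rightarrow> nat) list set" where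
  "graded_normal_rulings F =
     {\<rho>. length \<rho> = length F + 1 \<and>
         (\<forall>r\<le>length F. ffp_involution (length (slice F r)) (\<rho> ! r)) \<and>
         (\<forall>r<length F. ruling_step (F ! r) (slice F r) (\<rho> ! r) (\<rho> ! (r + 1)))}"

text \<open>
  Since \<open>\<rho> k \<noteq> k + 1\<close> at a crossing, conjugation by \<open>transpose k (k + 1)\<close> changes \<open>\<rho>\<close>; so the
  switches are exactly the crossings at which the pairing stays the same.
\<close>

definition switches :: "front \<Rightarrow> (nat \<Rightarrow> nat) list \<Rightarrow> nat set" where
  "switches F \<rho> = {r. r < length F \<and> (\<exists>k. F ! r = Cross k) \<and> \<rho> ! (r + 1) = \<rho> ! r}"

text \<open>Laurent polynomials in \<open>z\<close> are regarded as formal Laurent series, with \<open>z = fls_X\<close>.\<close>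

definition ruling_poly :: "front \<Rightarrow> int fls" where
  "ruling_poly F =
     (\<Sum>\<rho>\<in>graded_normal_rulings F.
        fls_X_intpow (int (card (switches F \<rho>)) - int (right_cusps F)))"


section \<open>Positive braids and rainbow closures\<close>

text \<open>
  A positive braid on \<open>n\<close> strands is given by a word in the generators, the letter \<open>i\<close> standing
  for \<open>\<sigma>\<^sub>i\<close>; the product of braids is the concatenation of words.
\<close>

definition braid_word :: "nat \<Rightarrow> nat list \<Rightarrow> bool" where
  "braid_word n w \<longleftrightarrow> set w \<subseteq> {1..<n}"

definition add_strands_below :: "nat \<Rightarrow> nat list \<Rightarrow> nat list" where
  "add_strands_below d w = map (\<lambda>i. i + d) w"

text \<open>
  The \<open>n\<close> left cusps are nested, the outermost one coming first. After them strands \<open>1, \<dots>, n\<close> are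
  those of the braid, all of Maslov potential 0 (oriented in parallel), and strands
  \<open>n + 1, \<dots>, 2n\<close> are the closing arcs above it, of Maslov potential 1.
\<close>

definition rainbow :: "nat \<Rightarrow> nat list \<Rightarrow> front" where
  "rainbow n w =
     map (\<lambda>k. LCusp k False) [1..<n + 1] @ map Cross w @ map RCusp (rev [1..<n + 1])"

text \<open>\<open>braid_perm [i\<^sub>1, \<dots>, i\<^sub>l]\<close> is \<open>s\<^bsub>i\<^sub>l\<^esub> \<circ> \<dots> \<circ> s\<^bsub>i\<^sub>1\<^esub>\<close>.\<close>

definition braid_perm :: "nat list \<Rightarrow> nat \<Rightarrow> nat" where
  "braid_perm w = fold (\<lambda>i p. transpose i (i + 1) \<circ> p) w id"

definition components :: "nat \<Rightarrow> nat list \<Rightarrow> nat" where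
  "components n w = card (orbit (braid_perm w) ` {1..n})"

definition normalized_ruling_poly :: "nat \<Rightarrow> nat list \<Rightarrow> int fls" where
  "normalized_ruling_poly n w =
     fls_X_intpow (int (components n w)) * ruling_poly (rainbow n w)"


section \<open>Coefficient sequences\<close>

definition log_concave :: "nat \<Rightarrow> (nat \<Rightarrow> real) \<Rightarrow> bool" where
  "log_concave \<delta> a \<longleftrightarrow>
     (\<forall>j\<le>\<delta>. 0 \<le> a j) \<and>
     (\<forall>j. 1 \<le> j \<and> j + 1 \<le> \<delta> \<longrightarrow> a (j - 1) * a (j + 1) \<le> (a j)\<^sup>2)"

definition no_internal_zeros :: "nat \<Rightarrow> (nat \<Rightarrow> real) \<Rightarrow> bool" where
  "no_internal_zeros \<delta> a \<longleftrightarrow>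
     \<not> (\<exists>i j k. i < j \<and> j < k \<and> k \<le> \<delta> \<and> 0 < a i \<and> 0 < a k \<and> a j = 0)"

text \<open>
  For a nonzero \<open>P\<close> that is a polynomial in \<open>z\<^sup>2\<close>: half its degree, and its coefficients
  with respect to the powers of \<open>z\<^sup>2\<close>.
\<close>

definition half_degree :: "int fls \<Rightarrow> nat" where
  "half_degree P = nat (Max {k. fls_nth P k \<noteq> 0}) div 2"

definition even_coeff :: "int fls \<Rightarrow> nat \<Rightarrow> real" where
  "even_coeff P j = real_of_int (fls_nth P (2 * int j))"

definition log_concave_coeffs :: "int fls \<Rightarrow> bool" where
  "log_concave_coeffs P \<longleftrightarrow>
     log_concave (half_degree P) (even_coeff P) \<and>
     no_internal_zeros (half_degree P) (even_coeff P)"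

end

theory Submission
  imports Defs
begin

text \<open>
  Just after the left cusps the pairing of a ruling matches strand \<open>i\<close> of the braid with the \<open>i\<close>-th
  closing strand from the top, and crossings of the braid only permute which closing strand each braid strand is
  matched with; so rulings are walks of injective height functions. Reading \<open>\<beta>\<^sub>1 \<gamma> \<beta>\<^sub>2\<close> from
  the left, \<open>\<beta>\<^sub>1\<close> leaves the strands above \<open>n\<close> in their initial positions, and \<open>\<beta>\<^sub>2\<close>
  cannot move them. Hence the part of a walk belonging to \<open>\<gamma>\<close> has to return to the height function at
  which it started, and since strand \<open>n\<close> is matched higher than the strands beyond it, this
  part is, up to an order isomorphism, a closed walk of \<open>\<gamma>\<close> alone. Removing it leaves a walk of
  \<open>\<beta>\<^sub>1 \<beta>\<^sub>2\<close>.

  For log-concavity, deleting the switched crossings from the braid turns its permutation into the identity, and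
  each transposition changes the number of cycles by one. So the normalized polynomials are polynomials in
  \<open>z\<^sup>2\<close>; they are multiplicative because the two permutations act on sets with one common point. The product
  of log-concave sequences without internal zeros is handled by the Cauchy--Binet formula for
  \<open>2 \<times> 2\<close> minors of Toeplitz matrices.
\<close>

section \<open>Rulings of rainbow closures as walks\<close>

text \<open>
  \<open>g i\<close> is the height of the closing strand paired with strand \<open>i\<close>; since closing strands lie above the
  braid, the disks at a crossing \<open>k\<close> are nested exactly if \<open>g (k + 1) < g k\<close>. In terms of the walks
  \<open>p\<^sub>r\<close> of the paper, \<open>g\<close> is \<open>p\<^sub>r\<inverse>\<close> up to a shift, so left multiplication becomes composition
  on the right.
\<close>

fun walk_sum :: "nat list \<Rightarrow> (nat \<Rightarrow> nat) \<Rightarrow> ((nat \<Rightarrow> nat) \<Rightarrow> int fls) \<Rightarrow> int fls" where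
  "walk_sum [] g \<phi> = \<phi> g"
| "walk_sum (k # w) g \<phi> =
     walk_sum w (g \<circ> transpose k (k + 1)) \<phi> +
     (if g (k + 1) < g k then fls_X * walk_sum w g \<phi> else 0)"

section \<open>State sums over the rulings of a front with a given beginning\<close>

definition rulings_from ::
  "bool list \<Rightarrow> front \<Rightarrow> (nat \<Rightarrow> nat) \<Rightarrow> (nat \<Rightarrow> nat) list set" where
  "rulings_from \<mu> F \<rho> =
     {\<tau>. length \<tau> = length F + 1 \<and> \<tau> ! 0 = \<rho> \<and>
         (\<forall>r\<le>length F. ffp_involution (length (fold pass (take r F) \<mu>)) (\<tau> ! r)) \<and>
         (\<forall>r<length F. ruling_step (F ! r) (fold pass (take r F) \<mu>) (\<tau> ! r) (\<tau> ! (r + 1)))}"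

definition next_pairings ::
  "front_event \<Rightarrow> bool list \<Rightarrow> (nat \<Rightarrow> nat) \<Rightarrow> (nat \<Rightarrow> nat) set" where
  "next_pairings e \<mu> \<rho> =
     {\<rho>'. ruling_step e \<mu> \<rho> \<rho>' \<and> ffp_involution (length (pass e \<mu>)) \<rho>'}"

definition switch_weight ::
  "front_event \<Rightarrow> (nat \<Rightarrow> nat) \<Rightarrow> (nat \<Rightarrow> nat) \<Rightarrow> int fls" where
  "switch_weight e \<rho> \<rho>' = (if (\<exists>k. e = Cross k) \<and> \<rho>' = \<rho> then fls_X else 1)"

text \<open>Transfer recursion, one singularity at a time. Each step checks only the next pairing;
  the condition on \<open>\<rho>\<close> itself enters in \<open>sum_rulings_from\<close>.\<close>

fun ruling_sum :: "front \<Rightarrow> bool list \<Rightarrow> (nat \<Rightarrow> nat) \<Rightarrow> int fls" where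
  "ruling_sum [] \<mu> \<rho> = 1"
| "ruling_sum (e # F) \<mu> \<rho> =
     (\<Sum>\<rho>'\<in>next_pairings e \<mu> \<rho>. switch_weight e \<rho> \<rho>' * ruling_sum F (pass e \<mu>) \<rho>')"

lemma finite_next_pairings [simp]: "finite (next_pairings e \<mu> \<rho>)"
  unfolding next_pairings_def ffp_involution_def
  by (rule finite_subset[OF _ finite_permutations[of "{1..length (pass e \<mu>)}"]]) auto

lemma rulings_from_Nil:
  "rulings_from \<mu> [] \<rho> = (if ffp_involution (length \<mu>) \<rho> then {[\<rho>]} else {})"
  by (auto simp: rulings_from_def length_Suc_conv)

lemma rulings_from_Cons:
  "rulings_from \<mu> (e # F) \<rho> =
     (if ffp_involution (length \<mu>) \<rho>
      then \<Union>\<rho>'\<in>next_pairings e \<mu> \<rho>. (#) \<rho> ` rulings_from (pass e \<mu>) F \<rho>' else {})"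
proof -
  have "\<tau> \<in> rulings_from \<mu> (e # F) \<rho> \<longleftrightarrow>
     (\<exists>\<tau>'. \<tau> = \<rho> # \<tau>' \<and> ffp_involution (length \<mu>) \<rho> \<and> \<tau>' ! 0 \<in> next_pairings e \<mu> \<rho> \<and>
        \<tau>' \<in> rulings_from (pass e \<mu>) F (\<tau>' ! 0))" for \<tau>
  proof (cases \<tau>)
    case (Cons \<rho>' \<tau>')
    then show ?thesis
      unfolding rulings_from_def next_pairings_def
      \<comment> \<open>Both bounded quantifiers are brought to the form \<open>r < Suc _\<close>,
        so that \<open>All_less_Suc2\<close> separates the head, at index 0, from the tail.\<close>
      by (auto simp: All_less_Suc2 less_Suc_eq_le[symmetric] simp del: less_Suc_eq_le)
  qed (auto simp: rulings_from_def)
  then show ?thesis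
    by (auto simp: image_iff) (auto simp: rulings_from_def)
qed

lemma switches_Cons:
  "card (switches (e # F) (\<rho> # \<tau>)) =
     (if (\<exists>k. e = Cross k) \<and> \<tau> ! 0 = \<rho> then 1 else 0) + card (switches F \<tau>)"
proof -
  have "switches (e # F) (\<rho> # \<tau>) =
     (if (\<exists>k. e = Cross k) \<and> \<tau> ! 0 = \<rho> then {0} else {}) \<union> Suc ` switches F \<tau>"
  proof (rule set_eqI)
    fix r
    show "r \<in> switches (e # F) (\<rho> # \<tau>) \<longleftrightarrow>
        r \<in> (if (\<exists>k. e = Cross k) \<and> \<tau> ! 0 = \<rho> then {0} else {}) \<union> Suc ` switches F \<tau>"
      unfolding switches_def by (cases r) (auto simp: image_iff)
  qed
  moreover have "finite (switches F \<tau>)"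
    by (rule finite_subset[of _ "{..<length F}"]) (auto simp: switches_def)
  ultimately show ?thesis
    by (auto simp: card_insert_if card_image)
qed

lemma finite_rulings_from: "finite (rulings_from \<mu> F \<rho>)"
  by (induction F arbitrary: \<mu> \<rho>) (auto simp: rulings_from_Nil rulings_from_Cons)

text \<open>Rulings are partitioned by their second pairing, and the first singularity contributes
  exactly one factor \<open>switch_weight\<close>; this is the recursion of
  \<open>ruling_sum\<close>.\<close>

lemma sum_rulings_from:
  "(\<Sum>\<tau>\<in>rulings_from \<mu> F \<rho>. fls_X ^ card (switches F \<tau>)) =
     (if ffp_involution (length \<mu>) \<rho> then ruling_sum F \<mu> \<rho> else 0)"
proof (induction F arbitrary: \<mu> \<rho>)
  case Nil
  then show ?case by (simp add: rulings_from_Nil switches_def)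
next
  case (Cons e F)
  show ?case
  proof (cases "ffp_involution (length \<mu>) \<rho>")
    case True
    have hd: "\<tau> ! 0 = \<rho>'" if "\<tau> \<in> rulings_from \<mu>' F \<rho>'" for \<tau> \<mu>' \<rho>'
      using that by (simp add: rulings_from_def)
    have "(\<Sum>\<tau>\<in>rulings_from \<mu> (e # F) \<rho>. fls_X ^ card (switches (e # F) \<tau>)) =
      (\<Sum>\<rho>'\<in>next_pairings e \<mu> \<rho>. \<Sum>\<tau>\<in>(#) \<rho> ` rulings_from (pass e \<mu>) F \<rho>'.
         fls_X ^ card (switches (e # F) \<tau>))"
      unfolding rulings_from_Cons if_P[OF True]
      by (rule sum.UNION_disjoint) (auto simp: finite_rulings_from dest: hd)
    also have "\<dots> = (\<Sum>\<rho>'\<in>next_pairings e \<mu> \<rho>. \<Sum>\<tau>\<in>rulings_from (pass e \<mu>) F \<rho>'.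
         switch_weight e \<rho> \<rho>' * fls_X ^ card (switches F \<tau>))"
      by (rule sum.cong[OF refl])
         (auto simp: sum.reindex switches_Cons switch_weight_def dest: hd intro!: sum.cong)
    also have "\<dots> = (\<Sum>\<rho>'\<in>next_pairings e \<mu> \<rho>.
         switch_weight e \<rho> \<rho>' * ruling_sum F (pass e \<mu>) \<rho>')"
      unfolding sum_distrib_left[symmetric] Cons.IH
      by (intro sum.cong) (auto simp: next_pairings_def)
    finally show ?thesis using True by simp
  qed (simp add: rulings_from_Cons)
qed

lemma ruling_poly_eq_ruling_sum:
  "ruling_poly F = fls_X_intpow (- int (right_cusps F)) * ruling_sum F [] id"
proof -
  have ffp0: "ffp_involution 0 \<rho> \<longleftrightarrow> \<rho> = id" for \<rho>
    by (auto simp: ffp_involution_def)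
  \<comment> \<open>To the left of all singularities there are no strands, so every ruling starts
    with the identity.\<close>
  have "graded_normal_rulings F = rulings_from [] F id"
    unfolding graded_normal_rulings_def rulings_from_def slice_def
    by (auto simp: ffp0[symmetric] dest: spec[of _ 0])
  moreover have "fls_X_intpow (int a - int b) = fls_X_intpow (- int b) * (fls_X :: int fls) ^ a"
    for a b
    unfolding fls_X_power_conv_shift_1
    using fls_X_intpow_times_fls_X_intpow[of "- int b" "int a", where ?'a = int]
    by simp
  ultimately show ?thesis
    unfolding ruling_poly_def
    by (simp add: sum_distrib_left[symmetric] sum_rulings_from ffp0)
qed

section \<open>The rainbow front: cusps and crossings\<close>

definition nested :: "nat \<Rightarrow> nat \<Rightarrow> nat" where
  "nested n i = (if i \<in> {1..2 * n} then 2 * n + 1 - i else i)"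

lemma ffp_nested: "ffp_involution (2 * n) (nested n)"
  unfolding ffp_involution_def
proof
  show "nested n permutes {1..2 * n}"
    by (rule bij_imp_permutes[OF bij_betw_byWitness[where f' = "nested n"]]) (auto simp: nested_def)
next
  show "\<forall>i\<in>{1..2 * n}. nested n (nested n i) = i \<and> nested n i \<noteq> i"
  proof
    fix i assume i: "i \<in> {1..2 * n}"
    then have "nested n i = 2 * n + 1 - i" "2 * n + 1 - i \<in> {1..2 * n}"
      by (auto simp: nested_def)
    moreover from this(2) have "nested n (2 * n + 1 - i) = i"
      using i by (auto simp: nested_def)
    moreover have "2 * n + 1 - i \<noteq> i" using i by auto presburger
    ultimately show "nested n (nested n i) = i \<and> nested n i \<noteq> i" by simp
  qed
qed

text \<open>The same condition governs a left cusp entered with \<open>nested n\<close> and a right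
  cusp left with \<open>nested n\<close>, so this serves both ends of the front. The cusp fixes the
  middle pair, and \<open>skip\<close> accounts for all other strands.\<close>

lemma nested_Suc_iff:
  "\<rho> (Suc n) = Suc n + 1 \<and> \<rho> \<circ> skip (Suc n) = skip (Suc n) \<circ> nested n \<longleftrightarrow> \<rho> = nested (Suc n)"
  if ffp: "ffp_involution (2 * Suc n) \<rho>"
proof
  assume *: "\<rho> (Suc n) = Suc n + 1 \<and> \<rho> \<circ> skip (Suc n) = skip (Suc n) \<circ> nested n"
  have top: "\<rho> (Suc (Suc n)) = Suc n"
  proof -
    have "\<rho> (\<rho> (Suc n)) = Suc n"
      using ffp by (simp add: ffp_involution_def)
    with * show ?thesis by simp
  qed
  show "\<rho> = nested (Suc n)"
  proof
    fix i
    have sk: "\<rho> (skip (Suc n) j) = skip (Suc n) (nested n j)" for j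
      using * by (simp add: fun_eq_iff)
    consider "i = Suc n" | "i = Suc (Suc n)" | "i < Suc n" | "i > Suc (Suc n)" by linarith
    then show "\<rho> i = nested (Suc n) i"
    proof cases
      case 3
      then show ?thesis using sk[of i] by (auto simp: skip_def nested_def)
    next
      case 4
      have "skip (Suc n) (i - 2) = i" using 4 by (simp add: skip_def) linarith
      then have "\<rho> i = skip (Suc n) (nested n (i - 2))" using sk[of "i - 2"] by simp
      also have "\<dots> = nested (Suc n) i" using 4 by (auto simp: skip_def nested_def)
      finally show ?thesis .
    qed (use * top in \<open>auto simp: nested_def\<close>)
  qed
next
  assume "\<rho> = nested (Suc n)"
  then show "\<rho> (Suc n) = Suc n + 1 \<and> \<rho> \<circ> skip (Suc n) = skip (Suc n) \<circ> nested n"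
    by (auto simp: nested_def skip_def fun_eq_iff)
qed

text \<open>The right cusps close the pairs from the inside out, each forcing the innermost one;
  only the nested pairing survives, with weight 1 because no crossing is passed.\<close>

lemma ruling_sum_RCusps:
  assumes "length \<mu> = 2 * n" "ffp_involution (2 * n) \<rho>"
  shows "ruling_sum (map RCusp (rev [1..<n + 1])) \<mu> \<rho> = of_bool (\<rho> = nested n)"
  using assms
proof (induction n arbitrary: \<mu> \<rho>)
  case 0
  then show ?case by (auto simp: ffp_involution_def nested_def)
next
  case (Suc n)
  have len: "length (pass (RCusp (Suc n)) \<mu>) = 2 * n"
    using Suc.prems by simp
  have "ruling_sum (map RCusp (rev [1..<Suc n + 1])) \<mu> \<rho> =
    (\<Sum>\<rho>'\<in>next_pairings (RCusp (Suc n)) \<mu> \<rho>. of_bool (\<rho>' = nested n))"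
    using Suc.IH[OF len]
    by (auto simp: switch_weight_def next_pairings_def len simp del: pass.simps intro!: sum.cong)
  also have "\<dots> = of_bool (nested n \<in> next_pairings (RCusp (Suc n)) \<mu> \<rho>)"
    by (simp add: of_bool_def)
  also have "nested n \<in> next_pairings (RCusp (Suc n)) \<mu> \<rho> \<longleftrightarrow> \<rho> = nested (Suc n)"
    unfolding next_pairings_def mem_Collect_eq len
    using nested_Suc_iff[OF Suc.prems(2)] ffp_nested by simp
  finally show ?case .
qed

lemma pass_LCusp_mid:
  "pass (LCusp (Suc n) False) (replicate n False @ replicate n True) =
     replicate (Suc n) False @ replicate (Suc n) True"
  by (simp add: replicate_app_Cons_same)

text \<open>Each left cusp admits exactly one continuation. \<open>F\<close> is kept arbitrary
  because the list of cusps grows at its right end, so the induction hands the last cusp over to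
  \<open>F\<close>.\<close>

lemma ruling_sum_LCusps:
  "ruling_sum (map (\<lambda>k. LCusp k False) [1..<n + 1] @ F) [] id =
     ruling_sum F (replicate n False @ replicate n True) (nested n)"
proof (induction n arbitrary: F)
  case 0
  have "nested 0 = id" by (auto simp: nested_def)
  then show ?case by simp
next
  case (Suc n)
  let ?\<mu> = "replicate n False @ replicate n True" and ?\<mu>' = "replicate (Suc n) False @ replicate (Suc n) True"
  have "next_pairings (LCusp (Suc n) False) ?\<mu> (nested n) = {nested (Suc n)}"
    unfolding next_pairings_def pass_LCusp_mid
    using nested_Suc_iff[of n] ffp_nested[of "Suc n"] by (auto simp: mult_2)
  then show ?case
    using Suc.IH[of "LCusp (Suc n) False # F"]
    by (simp add: switch_weight_def pass_LCusp_mid del: pass.simps replicate.simps)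
qed

text \<open>With the default 0, equality of height functions means agreement on the braid strands.
  The crossings of the braid preserve it, since they move only strands in
  \<open>{1..n}\<close>.\<close>

definition to_arcs :: "nat \<Rightarrow> (nat \<Rightarrow> nat) \<Rightarrow> nat \<Rightarrow> nat" where
  "to_arcs n \<rho> i = (if i \<in> {1..n} then \<rho> i else 0)"

lemma ffp_conj_transpose:
  assumes "ffp_involution s \<rho>" "k \<in> {1..s}" "l \<in> {1..s}"
  shows "ffp_involution s (transpose k l \<circ> \<rho> \<circ> transpose k l)"
proof -
  have t: "transpose k l permutes {1..s}"
    using assms by (simp add: permutes_swap_id)
  have "transpose k l \<circ> \<rho> \<circ> transpose k l permutes {1..s}"
    using assms(1) t by (auto simp: ffp_involution_def intro: permutes_compose)
  moreover have "transpose k l (\<rho> (transpose k l (transpose k l (\<rho> (transpose k l i))))) = i \<and>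
      transpose k l (\<rho> (transpose k l i)) \<noteq> i" if "i \<in> {1..s}" for i
  proof -
    define j where "j = transpose k l i"
    have "j \<in> {1..s}" using permutes_in_image[OF t] that by (simp add: j_def)
    then have "\<rho> (\<rho> j) = j" "\<rho> j \<noteq> j" using assms(1) by (auto simp: ffp_involution_def)
    moreover have i: "i = transpose k l j" by (simp add: j_def)
    ultimately show ?thesis by (simp add: inj_eq[OF inj_on_transpose])
  qed
  ultimately show ?thesis by (simp add: ffp_involution_def)
qed

text \<open>Crossings keep every braid strand matched with a closing arc, so companions never meet
  inside the braid. All braid strands have the same potential, hence normality alone decides whether
  a switch is allowed.\<close>

lemma ruling_sum_braid:
  assumes "braid_word n w" "ffp_involution (2 * n) \<rho>" "\<rho> ` {1..n} \<subseteq> {n<..2 * n}"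
  shows "ruling_sum (map Cross w @ map RCusp (rev [1..<n + 1]))
           (replicate n False @ replicate n True) \<rho> =
         walk_sum w (to_arcs n \<rho>) (\<lambda>g. of_bool (g = to_arcs n (nested n)))"
  using assms
proof (induction w arbitrary: \<rho>)
  case Nil
  \<comment> \<open>An involution that matches all braid strands with arcs is determined by its
    values on the braid strands.\<close>
  have "to_arcs n \<rho> = to_arcs n (nested n) \<longleftrightarrow> \<rho> = nested n"
  proof
    assume eq: "to_arcs n \<rho> = to_arcs n (nested n)"
    have low: "\<rho> i = 2 * n + 1 - i" if "i \<in> {1..n}" for i
      using fun_cong[OF eq, of i] that by (simp add: to_arcs_def nested_def)
    show "\<rho> = nested n"
    proof
      fix i
      consider "i \<in> {1..n}" | "i \<in> {n+1..2*n}" | "i \<notin> {1..2*n}" by force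
      then show "\<rho> i = nested n i"
      proof cases
        case 2
        define j where "j = 2 * n + 1 - i"
        have "j \<in> {1..n}" "i = 2 * n + 1 - j" using 2 by (auto simp: j_def)
        then have "\<rho> i = j" using low[of j] Nil.prems(2)
          by (metis (no_types, lifting) atLeastAtMost_iff ffp_involution_def le_trans mult_2 le_add1)
        then show ?thesis using 2 by (simp add: nested_def j_def)
      next
        case 3
        then have "\<rho> i = i" using Nil.prems(2)
          by (auto simp only: ffp_involution_def permutes_def)
        with 3 show ?thesis by (simp only: nested_def if_False)
      qed (simp add: low nested_def)
    qed
  qed simp
  then show ?case using Nil.prems by (simp add: ruling_sum_RCusps[simplified])
next
  case (Cons k w)
  let ?\<mu> = "replicate n False @ replicate n True" and ?t = "transpose k (k + 1)"
  let ?\<rho> = "?t \<circ> \<rho> \<circ> ?t"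
  have k: "1 \<le> k" "k < n" and w: "braid_word n w"
    using Cons.prems(1) by (auto simp: braid_word_def)
  have up: "n < \<rho> i" "\<rho> i \<le> 2 * n" if "1 \<le> i" "i \<le> n" for i
    using Cons.prems(3) that by (auto simp: image_subset_iff)
  have \<mu>: "?\<mu> ! (k - 1) = ?\<mu> ! k" using k by (simp add: nth_append)
  have "?\<mu>[k - 1 := ?\<mu> ! k] = ?\<mu>"
    unfolding \<mu>[symmetric] by (rule list_update_id)
  then have pass: "pass (Cross k) ?\<mu> = ?\<mu>"
    by (simp only: pass.simps \<mu> list_update_id)
  \<comment> \<open>Both disks contain \<open>k + 1\<close>, and the one of strand \<open>k\<close>
    starts lower; so the only possibility is that it contains the other.\<close>
  have normal: "normal_at k \<rho> \<longleftrightarrow> \<rho> (k + 1) < \<rho> k"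
  proof -
    have "\<rho> k \<noteq> \<rho> (k + 1)"
      using Cons.prems(2) by (metis ffp_involution_def inj_eq n_not_Suc_n permutes_inj Suc_eq_plus1)
    then show ?thesis
      using up[of k] up[of "k+1"] k by (auto simp: normal_at_def disk_def)
  qed
  have ne: "\<rho> k \<noteq> k + 1" using up[of k] k by simp
  have ffp: "ffp_involution (2 * n) ?\<rho>"
    using k Cons.prems(2) by (intro ffp_conj_transpose) auto
  have up': "?\<rho> ` {1..n} \<subseteq> {n<..2 * n}"
  proof safe
    fix i assume "i \<in> {1..n}"
    then have "1 \<le> ?t i" "?t i \<le> n" using k by (auto simp: transpose_def)
    from up[OF this] show "?\<rho> i \<in> {n<..2 * n}" using k by (auto simp: transpose_def)
  qed
  have arcs: "to_arcs n ?\<rho> = to_arcs n \<rho> \<circ> ?t"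
  proof
    fix i show "to_arcs n ?\<rho> i = (to_arcs n \<rho> \<circ> ?t) i"
    proof (cases "i \<in> {1..n}")
      case True
      then have "1 \<le> ?t i" "?t i \<le> n" using k by (auto simp: transpose_def)
      with up[OF this] True k show ?thesis by (auto simp: to_arcs_def transpose_def)
    qed (use k in \<open>auto simp: to_arcs_def transpose_def\<close>)
  qed
  have neq: "?\<rho> \<noteq> \<rho>"
  proof
    assume "?\<rho> = \<rho>"
    then have "?\<rho> k = \<rho> k" by simp
    then have "\<rho> (k + 1) = \<rho> k" using up[of "k+1"] up[of k] k by (auto simp: transpose_def)
    then show False
      using Cons.prems(2) by (metis ffp_involution_def inj_eq n_not_Suc_n permutes_inj Suc_eq_plus1)
  qed
  have np: "next_pairings (Cross k) ?\<mu> \<rho> = insert ?\<rho> (if \<rho> (k + 1) < \<rho> k then {\<rho>} else {})"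
    unfolding next_pairings_def pass using ne \<mu> normal ffp Cons.prems(2)
    by (auto simp: mult_2)
  let ?F = "map Cross w @ map RCusp (rev [1..<n + 1])"
  have "ruling_sum (map Cross (k # w) @ map RCusp (rev [1..<n + 1])) ?\<mu> \<rho> =
      ruling_sum ?F ?\<mu> ?\<rho> + (if \<rho> (k + 1) < \<rho> k then fls_X * ruling_sum ?F ?\<mu> \<rho> else 0)"
    unfolding list.map append_Cons ruling_sum.simps np pass
    using neq by (simp add: switch_weight_def)
  moreover have "to_arcs n \<rho> k = \<rho> k" "to_arcs n \<rho> (k + 1) = \<rho> (k + 1)"
    using k by (auto simp: to_arcs_def)
  ultimately show ?case
    unfolding walk_sum.simps Cons.IH[OF w ffp up'] Cons.IH[OF w Cons.prems(2,3)] arcs by simp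
qed

lemma ruling_poly_rainbow:
  assumes "braid_word n w"
  shows "ruling_poly (rainbow n w) = fls_X_intpow (- int n) *
    walk_sum w (to_arcs n (nested n)) (\<lambda>g. of_bool (g = to_arcs n (nested n)))"
proof -
  let ?P = "\<lambda>e. \<exists>k. e = RCusp k"
  have "filter ?P (map (\<lambda>k. LCusp k False) xs) = []" "filter ?P (map Cross xs) = []"
    "filter ?P (map RCusp xs) = map RCusp xs" for xs
    by (auto simp: filter_empty_conv filter_id_conv)
  then have "right_cusps (rainbow n w) = n"
    by (simp add: right_cusps_def rainbow_def del: upt_Suc)
  moreover have "nested n ` {1..n} \<subseteq> {n<..2 * n}"
    by (auto simp: nested_def)
  ultimately show ?thesis
    unfolding ruling_poly_eq_ruling_sum rainbow_def ruling_sum_LCusps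
    by (simp only: ruling_sum_braid[OF assms ffp_nested])
qed


section \<open>Stacking braids\<close>

lemma walk_sum_append:
  "walk_sum (u @ v) g \<phi> = walk_sum u g (\<lambda>f. walk_sum v f \<phi>)"
  by (induction u arbitrary: g) auto

lemma walk_sum_mult_right: "walk_sum w g (\<lambda>f. \<phi> f * c) = walk_sum w g \<phi> * c"
  by (induction w arbitrary: g) (auto simp: algebra_simps)

text \<open>A bisimulation principle: if related height functions stay related under corresponding
  crossings and allow the same switches, the two sums branch in the same way.\<close>

lemma walk_sum_transfer:
  assumes "R g g'"
    and "\<And>f f' k. R f f' \<Longrightarrow> k \<in> set w \<Longrightarrow>
      R (f \<circ> transpose (k + d) (k + d + 1)) (f' \<circ> transpose k (k + 1)) \<and>
      (f (k + d + 1) < f (k + d) \<longleftrightarrow> f' (k + 1) < f' k)"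
    and "\<And>f f'. R f f' \<Longrightarrow> \<phi> f = \<psi> f'"
  shows "walk_sum (add_strands_below d w) g \<phi> = walk_sum w g' \<psi>"
  using assms(1,2)
proof (induction w arbitrary: g g')
  case Nil
  then show ?case by (simp add: add_strands_below_def assms(3))
next
  case (Cons k w)
  have step: "R (g \<circ> transpose (k + d) (k + d + 1)) (g' \<circ> transpose k (k + 1))"
      "g (k + d + 1) < g (k + d) \<longleftrightarrow> g' (k + 1) < g' k"
    using Cons.prems(2)[OF Cons.prems(1) list.set_intros(1)] by blast+
  have IH: "walk_sum (add_strands_below d w) f \<phi> = walk_sum w f' \<psi>" if "R f f'" for f f'
    using that by (rule Cons.IH) (use Cons.prems(2) in auto)
  show ?case
    using IH[OF step(1)] IH[OF Cons.prems(1)] step(2) by (simp add: add_strands_below_def)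
qed

lemma walk_sum_cong:
  assumes "I g"
    and "\<And>f k. I f \<Longrightarrow> k \<in> set w \<Longrightarrow> I (f \<circ> transpose k (k + 1))"
    and "\<And>f. I f \<Longrightarrow> \<phi> f = \<psi> f"
  shows "walk_sum w g \<phi> = walk_sum w g \<psi>"
proof -
  have "walk_sum (add_strands_below 0 w) g \<phi> = walk_sum w g \<psi>"
    by (rule walk_sum_transfer[where R = "\<lambda>f f'. f = f' \<and> I f"]) (use assms in auto)
  then show ?thesis by (simp add: add_strands_below_def)
qed

text \<open>Switches depend only on the relative order of the heights, so an order embedding
  \<open>e\<close> of the heights changes nothing. The bound on the image in the relation keeps all
  values where \<open>e\<close> is known to be monotone.\<close>

lemma walk_sum_embed:
  assumes w: "braid_word m w"
    and emb: "\<And>i. i \<in> {1..m} \<Longrightarrow> g (i + d) = e (g' i)" "\<And>i. i \<in> {1..m} \<Longrightarrow> h (i + d) = e (h' i)"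
    and mono: "strict_mono_on (g' ` {1..m} \<union> h' ` {1..m}) e"
    and out: "\<And>j. j \<notin> {1 + d..m + d} \<Longrightarrow> g j = h j" "\<And>j. j \<notin> {1..m} \<Longrightarrow> g' j = h' j"
  shows "walk_sum (add_strands_below d w) g (\<lambda>f. of_bool (f = h)) =
    walk_sum w g' (\<lambda>f. of_bool (f = h'))"
proof (rule walk_sum_transfer[where R = "\<lambda>f f'. (\<forall>i\<in>{1..m}. f (i + d) = e (f' i)) \<and>
    f' ` {1..m} \<subseteq> g' ` {1..m} \<and> (\<forall>j. j \<notin> {1 + d..m + d} \<longrightarrow> f j = h j) \<and>
    (\<forall>j. j \<notin> {1..m} \<longrightarrow> f' j = h' j)"], goal_cases)
  case 1
  then show ?case using emb(1) out by simp
next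
  case (2 f f' k)
  then have k: "1 \<le> k" "k < m" using w by (auto simp: braid_word_def)
  have t: "transpose k (k + 1) i \<in> {1..m}" if "i \<in> {1..m}" for i
    using that k by (auto simp: transpose_def)
  have td: "transpose (k + d) (k + d + 1) (i + d) = transpose k (k + 1) i + d" for i
    by (auto simp: transpose_def)
  have tj: "transpose (k + d) (k + d + 1) j = j" if "j \<notin> {1 + d..m + d}" for j
    using that k by (auto simp: transpose_def)
  have tj': "transpose k (k + 1) j = j" if "j \<notin> {1..m}" for j
    using that k by (auto simp: transpose_def)
  have in_g': "f' i \<in> g' ` {1..m} \<union> h' ` {1..m}" if "i \<in> {1..m}" for i
    using 2 that by blast
  have "f (k + d + 1) = e (f' (k + 1))" "f (k + d) = e (f' k)"
    using 2 k by (auto dest: bspec[of _ _ "k + 1"] simp: add_ac)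
  then have "f (k + d + 1) < f (k + d) \<longleftrightarrow> f' (k + 1) < f' k"
    using strict_mono_on_less[OF mono in_g' in_g', of "k + 1" k] k by simp
  moreover have "\<forall>i\<in>{1..m}. (f \<circ> transpose (k + d) (k + d + 1)) (i + d) =
      e ((f' \<circ> transpose k (k + 1)) i)"
    unfolding comp_def td using 2 t by blast
  moreover have "(f' \<circ> transpose k (k + 1)) ` {1..m} \<subseteq> g' ` {1..m}"
    using 2 t by (auto simp del: atLeastAtMost_iff)
  ultimately show ?case
    using 2 tj tj' by simp
next
  case (3 f f')
  have "f = h \<longleftrightarrow> f' = h'"
  proof
    assume fh: "f = h"
    show "f' = h'"
    proof
      fix i show "f' i = h' i"
      proof (cases "i \<in> {1..m}")
        case True
        then have "f' i \<in> g' ` {1..m} \<union> h' ` {1..m}" "h' i \<in> g' ` {1..m} \<union> h' ` {1..m}"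
          using 3 by blast+
        moreover have "e (f' i) = e (h' i)" using 3 True fh emb(2)[OF True] by simp
        ultimately show ?thesis
          using strict_mono_on_eqD[OF mono] by metis
      qed (use 3 in blast)
    qed
  next
    assume fh: "f' = h'"
    show "f = h"
    proof
      fix j show "f j = h j"
      proof (cases "j \<in> {1 + d..m + d}")
        case True
        then have "j - d \<in> {1..m}" "j = (j - d) + d" by auto
        then show ?thesis using 3 fh emb(2) by metis
      qed (use 3 in blast)
    qed
  qed
  then show ?case by simp
qed

text \<open>The letters of \<open>w\<close> never move strand \<open>j\<close>, so no walk from
  \<open>g\<close> ends in \<open>h\<close>.\<close>

lemma walk_sum_eq_0:
  assumes "braid_word n w" "j \<notin> {1..n}" "g j \<noteq> h j"
  shows "walk_sum w g (\<lambda>f. of_bool (f = h)) = 0"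
proof -
  have "walk_sum w g (\<lambda>f. of_bool (f = h)) = walk_sum w g (\<lambda>f. 1 * 0)"
  proof (rule walk_sum_cong[where I = "\<lambda>f. f j \<noteq> h j"])
    fix f k assume "f j \<noteq> h j" "k \<in> set w"
    moreover from this have "1 \<le> k" "k < n" using assms(1) by (auto simp: braid_word_def)
    ultimately show "(f \<circ> transpose k (k + 1)) j \<noteq> h j"
      using assms(2) by (auto simp: transpose_def)
  qed (use assms in auto)
  then show ?thesis using walk_sum_mult_right[of w g "\<lambda>f. 1" 0] by simp
qed

lemma nested_low: "to_arcs n (nested n) i = (if i \<in> {1..n} then 2 * n + 1 - i else 0)"
  by (auto simp: to_arcs_def nested_def)

abbreviation closed_walk_sum :: "nat \<Rightarrow> nat list \<Rightarrow> int fls" where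
  "closed_walk_sum n w \<equiv>
     walk_sum w (to_arcs n (nested n)) (\<lambda>f. of_bool (f = to_arcs n (nested n)))"

lemma closed_walk_sum_stack:
  assumes nm: "n \<ge> 1" "m \<ge> 1"
    and w: "braid_word n \<beta>1" "braid_word n \<beta>2" "braid_word m \<gamma>"
  shows "closed_walk_sum (n + m - 1) (\<beta>1 @ add_strands_below (n - 1) \<gamma> @ \<beta>2) =
    closed_walk_sum m \<gamma> * closed_walk_sum n (\<beta>1 @ \<beta>2)"
proof -
  define N where "N = n + m - 1"
  define h where "h = to_arcs N (nested N)"
  let ?\<delta> = "\<lambda>f. of_bool (f = h)"
  \<comment> \<open>Invariant along \<open>\<beta>1\<close>: the strands above \<open>n\<close> are
    untouched, and the first \<open>n\<close> strands keep the \<open>n\<close> largest heights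
    among themselves.\<close>
  let ?I = "\<lambda>f. (\<forall>j. j \<notin> {1..n} \<longrightarrow> f j = h j) \<and> inj_on f {1..n} \<and> f ` {1..n} \<subseteq> {2 * N + 1 - n..2 * N}"
  have N: "N = n + m - 1" "n \<le> N" using nm by (auto simp: N_def)
  have h: "h i = (if i \<in> {1..N} then 2 * N + 1 - i else 0)" for i
    by (simp only: h_def nested_low)
  have inner: "walk_sum (add_strands_below (n - 1) \<gamma>) f (\<lambda>f'. walk_sum \<beta>2 f' ?\<delta>) =
      closed_walk_sum m \<gamma> * walk_sum \<beta>2 f ?\<delta>" if I: "?I f" for f
  proof -
    have fn: "2 * N + 1 - n \<le> f n" "f n \<le> 2 * N"
      using I nm by (auto simp: image_subset_iff)
    \<comment> \<open>Invariant along the shifted \<open>\<gamma>\<close>: it only permutes the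
      heights on strands \<open>n\<close> to \<open>N\<close>.\<close>
    let ?J = "\<lambda>f'. (\<forall>j. j \<notin> {n..N} \<longrightarrow> f' j = f j) \<and> inj_on f' {n..N} \<and> f' ` {n..N} \<subseteq> f ` {n..N}"
    have "walk_sum (add_strands_below (n - 1) \<gamma>) f (\<lambda>f'. walk_sum \<beta>2 f' ?\<delta>) =
      walk_sum (add_strands_below (n - 1) \<gamma>) f (\<lambda>f'. of_bool (f' = f) * walk_sum \<beta>2 f ?\<delta>)"
    proof (rule walk_sum_cong[where I = ?J])
      have "inj_on f {n..N}"
      proof (rule inj_onI)
        fix i j assume ij: "i \<in> {n..N}" "j \<in> {n..N}" "f i = f j"
        have "f l = 2 * N + 1 - l" if "n < l" "l \<le> N" for l
          using I that h[of l] by auto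
        with ij show "i = j" using fn N(2)
          by (cases "i = n"; cases "j = n") auto
      qed
      then show "?J f" by simp
    next
      fix f' k assume J: "?J f'" and "k \<in> set (add_strands_below (n - 1) \<gamma>)"
      then obtain i where i: "k = i + (n - 1)" "i \<in> set \<gamma>"
        by (auto simp: add_strands_below_def)
      then have "1 \<le> i" "i < m" using w(3) by (auto simp: braid_word_def)
      then have k: "n \<le> k" "k < N" using i(1) nm N(1) by linarith+
      let ?t = "transpose k (k + 1)"
      have t: "?t permutes {n..N}" using k by (simp add: permutes_swap_id)
      then have im: "?t ` {n..N} = {n..N}" by (rule permutes_image)
      have "inj_on (f' \<circ> ?t) {n..N}"
        using J im by (simp add: comp_inj_on permutes_inj_on[OF t])
      moreover have "(f' \<circ> ?t) ` {n..N} = f' ` {n..N}"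
        by (simp only: image_comp[symmetric] im)
      moreover have "?t j = j" if "j \<notin> {n..N}" for j
        using t that by (simp add: permutes_not_in)
      ultimately show "?J (f' \<circ> ?t)" using J by (simp del: atLeastAtMost_iff)
    next
      fix f' assume J: "?J f'"
      show "walk_sum \<beta>2 f' ?\<delta> = of_bool (f' = f) * walk_sum \<beta>2 f ?\<delta>"
      \<comment> \<open>If a strand above \<open>n\<close> is out of place, \<open>\<beta>2\<close>
        cannot repair it. Otherwise \<open>f'\<close> agrees with \<open>f\<close> off
        \<open>n\<close>, and injectivity leaves only \<open>f n\<close> as the value at
        \<open>n\<close>.\<close>
      proof (cases "\<exists>j. j \<notin> {1..n} \<and> f' j \<noteq> h j")
        case True
        then obtain j where j: "j \<notin> {1..n}" "f' j \<noteq> h j" by blast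
        then have "f' \<noteq> f" using I by auto
        with walk_sum_eq_0[OF w(2) j(1), of f' h] j(2) show ?thesis by simp
      next
        case False
        have other: "f' j = f j" if "j \<noteq> n" for j
          using False I J that by (cases "j \<in> {1..n}") auto
        have "f' n \<in> f ` {n..N}" using J N by (simp add: image_subset_iff)
        then obtain j where j: "j \<in> {n..N}" "f' n = f j" by blast
        have "j = n"
        proof (rule ccontr)
          assume "j \<noteq> n"
          with other[of j] j have "f' n = f' j" by simp
          with J j(1) N \<open>j \<noteq> n\<close> show False by (auto dest: inj_onD)
        qed
        with j other have "f' = f" by (metis ext)
        then show ?thesis by simp
      qed
    qed
    also have "\<dots> = walk_sum (add_strands_below (n - 1) \<gamma>) f (\<lambda>f'. of_bool (f' = f)) *
        walk_sum \<beta>2 f ?\<delta>"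
      by (rule walk_sum_mult_right)
    also have "walk_sum (add_strands_below (n - 1) \<gamma>) f (\<lambda>f'. of_bool (f' = f)) =
        closed_walk_sum m \<gamma>"
    proof -
      \<comment> \<open>Strand 1 of \<open>\<gamma>\<close> is strand \<open>n\<close> of the big
        braid. Its initial height \<open>2 * m\<close> is the largest one and corresponds to
        \<open>f n\<close>, which exceeds the heights of all strands above \<open>n\<close>; those
        differ from the heights in \<open>\<gamma>\<close> by a shift of
        \<open>n - 1\<close>.\<close>
      let ?e = "\<lambda>v. if v = 2 * m then f n else v + (n - 1)"
      have val: "f (i + (n - 1)) = ?e (to_arcs m (nested m) i)" if "i \<in> {1..m}" for i
      proof (cases "i = 1")
        case True
        then show ?thesis using that nm by (simp add: nested_low)
      next
        case False
        then have "i + (n - 1) \<notin> {1..n}" using that nm by auto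
        then have "f (i + (n - 1)) = h (i + (n - 1))" using I by blast
        moreover have "h (i + (n - 1)) = 2 * N + 1 - (i + (n - 1))"
        proof -
          have "i + (n - 1) \<in> {1..N}" using that nm N(1) unfolding atLeastAtMost_iff by linarith
          then show ?thesis by (simp only: h if_True)
        qed
        moreover have "2 * N + 1 - (i + (n - 1)) = 2 * m + 1 - i + (n - 1)"
          using that nm N(1) by auto
        moreover have "to_arcs m (nested m) i = 2 * m + 1 - i" "2 * m + 1 - i \<noteq> 2 * m"
          using that False by (auto simp: nested_low)
        ultimately show ?thesis by (simp only: if_False)
      qed
      have "strict_mono_on {m + 1..2 * m} ?e"
        using fn N(1) nm by (intro strict_mono_onI) auto
      then have mono: "strict_mono_on (to_arcs m (nested m) ` {1..m} \<union> to_arcs m (nested m) ` {1..m}) ?e"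
        by (rule monotone_on_subset) (auto simp: nested_low)
      show ?thesis
        by (intro walk_sum_embed[where e = ?e, OF w(3)]) (rule val mono refl | assumption)+
    qed
    finally show ?thesis .
  qed
  have "closed_walk_sum N (\<beta>1 @ add_strands_below (n - 1) \<gamma> @ \<beta>2) =
     walk_sum \<beta>1 h (\<lambda>f. walk_sum (add_strands_below (n - 1) \<gamma>) f (\<lambda>f'. walk_sum \<beta>2 f' ?\<delta>))"
    by (simp only: walk_sum_append h_def)
  also have "\<dots> = walk_sum \<beta>1 h (\<lambda>f. walk_sum \<beta>2 f ?\<delta> * closed_walk_sum m \<gamma>)"
  proof (rule walk_sum_cong[where I = ?I])
    show "?I h" using N by (auto simp: h inj_on_def)
  next
    fix f k assume I: "?I f" and "k \<in> set \<beta>1"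
    then have k: "1 \<le> k" "k < n"
      using w(1) by (auto simp: braid_word_def)
    let ?t = "transpose k (k + 1)"
    have t: "?t permutes {1..n}" using k by (simp add: permutes_swap_id)
    then have im: "?t ` {1..n} = {1..n}" by (rule permutes_image)
    have "inj_on (f \<circ> ?t) {1..n}"
      using I im by (simp add: comp_inj_on permutes_inj_on[OF t])
    moreover have "(f \<circ> ?t) ` {1..n} = f ` {1..n}"
      by (simp only: image_comp[symmetric] im)
    moreover have "?t j = j" if "j \<notin> {1..n}" for j
      using t that by (simp add: permutes_not_in)
    ultimately show "?I (f \<circ> ?t)" using I by (simp del: atLeastAtMost_iff)
  next
    fix f assume "?I f"
    from inner[OF this] show "walk_sum (add_strands_below (n - 1) \<gamma>) f (\<lambda>f'. walk_sum \<beta>2 f' ?\<delta>) =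
        walk_sum \<beta>2 f ?\<delta> * closed_walk_sum m \<gamma>"
      by (simp only: mult.commute)
  qed
  also have "\<dots> = closed_walk_sum m \<gamma> * walk_sum (\<beta>1 @ \<beta>2) h ?\<delta>"
    by (simp only: walk_sum_append walk_sum_mult_right mult.commute)
  also have "walk_sum (\<beta>1 @ \<beta>2) h ?\<delta> = closed_walk_sum n (\<beta>1 @ \<beta>2)"
  proof -
    \<comment> \<open>The shift is \<open>2 * N - 2 * n\<close>, the difference of the top
      heights.\<close>
    let ?e = "\<lambda>v. v + (2 * m - 2)"
    have val: "h (i + 0) = ?e (to_arcs n (nested n) i)" if "i \<in> {1..n}" for i
      using that N nm by (auto simp: h nested_low)
    have "braid_word n (\<beta>1 @ \<beta>2)" using w by (auto simp: braid_word_def)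
    then have "walk_sum (add_strands_below 0 (\<beta>1 @ \<beta>2)) h ?\<delta> = closed_walk_sum n (\<beta>1 @ \<beta>2)"
      by (rule walk_sum_embed[where e = ?e])
        (rule val refl | assumption | simp add: strict_mono_on_def)+
    then show ?thesis by (simp add: add_strands_below_def)
  qed
  finally show ?thesis by (simp only: N_def)
qed

lemma ruling_poly_stack:
  assumes nm: "n \<ge> 1" "m \<ge> 1"
    and w: "braid_word n \<beta>1" "braid_word n \<beta>2" "braid_word m \<gamma>"
  shows "ruling_poly (rainbow (n + m - 1) (\<beta>1 @ add_strands_below (n - 1) \<gamma> @ \<beta>2)) =
    fls_X * ruling_poly (rainbow m \<gamma>) * ruling_poly (rainbow n (\<beta>1 @ \<beta>2))"
proof -
  have "braid_word (n + m - 1) (\<beta>1 @ add_strands_below (n - 1) \<gamma> @ \<beta>2)"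
    "braid_word n (\<beta>1 @ \<beta>2)"
    using assms by (fastforce simp: braid_word_def add_strands_below_def)+
  note ruling_poly_rainbow[OF this(1)] ruling_poly_rainbow[OF this(2)] ruling_poly_rainbow[OF w(3)]
  \<comment> \<open>The stacked closure has one right cusp fewer than the other two together, whence
    the factor z.\<close>
  moreover have "fls_X_intpow (- int (n + m - 1)) =
      fls_X * fls_X_intpow (- int m) * (fls_X_intpow (- int n) :: int fls)"
  proof -
    have "- int (n + m - 1) = 1 + - int m + - int n" using nm by simp
    then show ?thesis
      by (simp only: fls_X_intpow_times_fls_X_intpow[symmetric] fls_X_conv_shift_1)
  qed
  ultimately show ?thesis
    by (simp only: closed_walk_sum_stack[OF assms] mult_ac)
qed


section \<open>Counting orbits\<close>

definition num_orbits :: "('a \<Rightarrow> 'a) \<Rightarrow> 'a set \<Rightarrow> nat" where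
  "num_orbits p S = card (orbit p ` S)"

lemma in_orbit_iff:
  assumes "permutation p"
  shows "y \<in> orbit p x \<longleftrightarrow> orbit p y = orbit p x"
proof
  assume y: "y \<in> orbit p x"
  then have "x \<in> orbit p y"
    using permutation_self_in_orbit[OF assms] orbit_swap by metis
  with y show "orbit p y = orbit p x" using orbit_trans by fast
next
  assume "orbit p y = orbit p x"
  with permutation_self_in_orbit[OF assms, of y] show "y \<in> orbit p x" by simp
qed

lemma permutation_swap_comp:
  "permutation p \<Longrightarrow> permutation (transpose a b \<circ> p)"
  by (simp add: permutation_compose permutation_swap_id)

text \<open>Along the orbit of \<open>a\<close> the transposition changes only the arrow returning
  to \<open>a\<close>, which now leads to \<open>b\<close>.\<close>

lemma orbit_swap_comp_superset:
  assumes p: "permutation p" and b: "b \<notin> orbit p a"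
  shows "orbit p a \<subseteq> orbit (transpose a b \<circ> p) a" "b \<in> orbit (transpose a b \<circ> p) a"
proof -
  let ?p' = "transpose a b \<circ> p"
  have self: "a \<in> orbit ?p' a"
    by (intro permutation_self_in_orbit permutation_swap_comp p)
  have next_in: "p y \<in> orbit ?p' a" if "y \<in> orbit ?p' a" "p y \<in> orbit p a" for y
  proof (cases "p y = a")
    case False
    with that b have "?p' y = p y" by (auto simp: transpose_def)
    with orbit.step[OF that(1)] show ?thesis by simp
  qed (simp add: self)
  show sub: "orbit p a \<subseteq> orbit ?p' a"
  proof
    fix y assume "y \<in> orbit p a"
    then show "y \<in> orbit ?p' a"
    proof induction
      case base
      show ?case by (rule next_in[OF self orbit.base])
    next
      case (step y)
      show ?case by (rule next_in[OF step.IH orbit.step[OF step.hyps]])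
    qed
  qed
  have "a \<in> orbit p a" by (rule permutation_self_in_orbit[OF p])
  then have "\<exists>c\<in>orbit p a. p c = a"
    by (cases rule: orbit.cases) (use \<open>a \<in> orbit p a\<close> in metis)+
  then obtain c where c: "c \<in> orbit p a" "p c = a" by blast
  with sub have "?p' c \<in> orbit ?p' a" by (blast intro: orbit.step)
  with c show "b \<in> orbit ?p' a" by simp
qed

text \<open>One inclusion is the previous lemma applied with both orders of \<open>a\<close> and
  \<open>b\<close>; for the other, the union of the two orbits is closed under the new map.\<close>

lemma orbit_swap_comp_merge:
  assumes p: "permutation p" and b: "b \<notin> orbit p a"
  shows "orbit (transpose a b \<circ> p) a = orbit p a \<union> orbit p b"
proof
  let ?p' = "transpose a b \<circ> p"
  have "a \<notin> orbit p b" using b by (simp add: in_orbit_iff[OF p])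
  then have "orbit p b \<subseteq> orbit ?p' b"
    using orbit_swap_comp_superset(1)[OF p, of a b] by (simp add: transpose_commute)
  moreover have "orbit ?p' b = orbit ?p' a"
    using orbit_swap_comp_superset(2)[OF assms] by (simp add: in_orbit_iff permutation_swap_comp p)
  ultimately show "orbit p a \<union> orbit p b \<subseteq> orbit ?p' a"
    using orbit_swap_comp_superset(1)[OF assms] by blast
  have "a \<in> orbit p a" "b \<in> orbit p b" by (auto intro: permutation_self_in_orbit[OF p])
  then have closed: "?p' y \<in> orbit p a \<union> orbit p b" if "y \<in> orbit p a \<union> orbit p b" for y
    using that by (auto simp: transpose_def intro: orbit.step)
  show "orbit ?p' a \<subseteq> orbit p a \<union> orbit p b"
  proof
    fix y assume "y \<in> orbit ?p' a"
    then show "y \<in> orbit p a \<union> orbit p b"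
      by induction (use closed \<open>a \<in> orbit p a\<close> in blast)+
  qed
qed

lemma orbit_swap_comp_split:
  assumes b: "b \<in> orbit p a" and "a \<noteq> b"
  shows "b \<notin> orbit (transpose a b \<circ> p) a"
proof -
  let ?p' = "transpose a b \<circ> p"
  define n where "n = (LEAST n. (p ^^ n) a = b)"
  \<comment> \<open>The path from \<open>a\<close> up to just before the first visit to
    \<open>b\<close>. The transposition sends its last point back to \<open>a\<close> instead of on
    to \<open>b\<close>, so the path becomes closed.\<close>
  define X where "X = (\<lambda>i. (p ^^ i) a) ` {..<n}"
  have n: "(p ^^ n) a = b"
    unfolding n_def by (rule LeastI_ex) (use b in \<open>auto simp: orbit_altdef\<close>)
  have least: "(p ^^ i) a \<noteq> b" if "i < n" for i
    using that not_less_Least unfolding n_def by blast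
  have "0 < n" using n \<open>a \<noteq> b\<close> by (cases n) auto
  then have "a \<in> X" by (auto simp: X_def image_iff intro: bexI[of _ 0])
  have closed: "?p' x \<in> X" if "x \<in> X" for x
  proof -
    obtain i where i: "i < n" "x = (p ^^ i) a" using \<open>x \<in> X\<close> by (auto simp: X_def)
    show ?thesis
    proof (cases "Suc i = n")
      case True
      then have "p x = b" using n i by auto
      then show ?thesis using \<open>a \<in> X\<close> by simp
    next
      case False
      then have "Suc i < n" using i by simp
      have px: "p x = (p ^^ Suc i) a" using i by simp
      have "p x \<noteq> b" unfolding px by (rule least) fact
      \<comment> \<open>A return to \<open>a\<close> before \<open>b\<close> would give an earlier
        visit to \<open>b\<close>.\<close>
      moreover have "p x \<noteq> a"
      proof
        assume "p x = a"
        then have "(p ^^ (n - Suc i)) a = (p ^^ (n - Suc i)) ((p ^^ Suc i) a)"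
          using px by simp
        also have "\<dots> = (p ^^ (n - Suc i + Suc i)) a"
          by (simp only: funpow_add comp_apply)
        also have "\<dots> = b" using n \<open>Suc i < n\<close> by simp
        finally show False using least[of "n - Suc i"] \<open>Suc i < n\<close> by simp
      qed
      moreover have "p x \<in> X" using px \<open>Suc i < n\<close> by (auto simp: X_def simp del: funpow.simps)
      ultimately show ?thesis by (simp add: transpose_def)
    qed
  qed
  have "orbit ?p' a \<subseteq> X"
  proof
    fix y assume "y \<in> orbit ?p' a"
    then show "y \<in> X" by induction (use closed \<open>a \<in> X\<close> in blast)+
  qed
  moreover have "b \<notin> X" using least by (auto simp: X_def)
  ultimately show ?thesis by blast
qed

lemma num_orbits_merge:
  assumes S: "finite S" "p permutes S" "a \<in> S" "b \<in> S" and b: "b \<notin> orbit p a"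
  shows "num_orbits p S = num_orbits (transpose a b \<circ> p) S + 1"
proof -
  let ?p' = "transpose a b \<circ> p"
  let ?A = "orbit p a" and ?B = "orbit p b"
  let ?R = "orbit p ` (S - (?A \<union> ?B))"
  have p: "permutation p" using S permutation_permutes by blast
  note self = permutation_self_in_orbit[OF p]
  have AB: "?A \<subseteq> S" "?B \<subseteq> S" using permutes_orbit_subset[OF S(2)] S(3,4) by auto
  have split: "f ` S = f ` (S \<inter> (?A \<union> ?B)) \<union> f ` (S - (?A \<union> ?B))" for f :: "'a \<Rightarrow> 'a set"
    by (simp only: image_Un[symmetric] Int_Diff_Un)
  have cls: "orbit p x = ?A" if "x \<in> ?A" for x using that in_orbit_iff[OF p] by blast
  have cls': "orbit p x = ?B" if "x \<in> ?B" for x using that in_orbit_iff[OF p] by blast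
  have "orbit p ` (S \<inter> (?A \<union> ?B)) = {?A, ?B}"
  proof
    show "orbit p ` (S \<inter> (?A \<union> ?B)) \<subseteq> {?A, ?B}" using cls cls' by blast
    show "{?A, ?B} \<subseteq> orbit p ` (S \<inter> (?A \<union> ?B))" using S(3,4) self by blast
  qed
  then have "orbit p ` S = insert ?A (insert ?B ?R)"
    unfolding split[of "orbit p"] by simp
  moreover have "orbit ?p' ` S = insert (?A \<union> ?B) ?R"
  proof -
    have in_AB: "orbit ?p' x = ?A \<union> ?B" if "x \<in> ?A \<union> ?B" for x
      using that unfolding orbit_swap_comp_merge[OF p b, symmetric]
      by (simp only: in_orbit_iff[OF permutation_swap_comp[OF p]])
    have out: "orbit ?p' x = orbit p x" if "x \<notin> ?A \<union> ?B" for x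
    proof (rule orbit_cong[OF self])
      fix s assume "s \<in> orbit p x"
      then have ps: "p s \<in> orbit p x" by (rule orbit.step)
      have "p s \<noteq> a" "p s \<noteq> b" using ps that self[of x] in_orbit_iff[OF p] by blast+
      then show "?p' s = p s" by (simp add: transpose_def)
    qed
    note split[of "orbit ?p'"]
    also have "orbit ?p' ` (S - (?A \<union> ?B)) = ?R" by (rule image_cong[OF refl out]) blast
    also have "orbit ?p' ` (S \<inter> (?A \<union> ?B)) = {?A \<union> ?B}"
    proof
      show "orbit ?p' ` (S \<inter> (?A \<union> ?B)) \<subseteq> {?A \<union> ?B}" using in_AB by blast
      show "{?A \<union> ?B} \<subseteq> orbit ?p' ` (S \<inter> (?A \<union> ?B))"
        using in_AB[of a] S(3) self[of a] by blast
    qed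
    finally show ?thesis unfolding insert_is_Un[of "?A \<union> ?B" ?R] .
  qed
  moreover have "?A \<notin> ?R" "?B \<notin> ?R" "?A \<noteq> ?B"
    using b self by blast+
  moreover have "?A \<union> ?B \<notin> ?R"
  proof
    assume "?A \<union> ?B \<in> ?R"
    then obtain x where x: "x \<notin> ?A \<union> ?B" "?A \<union> ?B = orbit p x" by blast
    with self[of x] show False by blast
  qed
  ultimately show ?thesis using S(1) by (simp add: num_orbits_def)
qed

text \<open>A transposition either merges two orbits or splits one; a split is a merge undone by the
  same transposition.\<close>

lemma num_orbits_swap:
  assumes S: "finite S" "p permutes S" "a \<in> S" "b \<in> S" "a \<noteq> b"
  shows "\<bar>int (num_orbits (transpose a b \<circ> p) S) - int (num_orbits p S)\<bar> = 1"
proof (cases "b \<in> orbit p a")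
  case False
  with num_orbits_merge[OF S(1-4)] show ?thesis by simp
next
  case True
  have "transpose a b \<circ> p permutes S"
    using S by (simp add: permutes_compose permutes_swap_id)
  from num_orbits_merge[OF S(1) this S(3,4) orbit_swap_comp_split[OF True S(5)]]
  show ?thesis by (simp add: o_assoc[symmetric] comp_assoc[symmetric])
qed

lemma num_orbits_disjoint:
  assumes "finite S" "finite T" "S \<inter> T = {}" "p permutes S" "r permutes T"
  shows "num_orbits (r \<circ> p) (S \<union> T) = num_orbits p S + num_orbits r T"
proof -
  have S: "orbit (r \<circ> p) x = orbit p x" if "x \<in> S" for x
  proof (rule orbit_cong0[OF that])
    show "(r \<circ> p) y = p y" if "y \<in> S" for y
      using that assms(3) permutes_in_image[OF assms(4), of y]
      by (auto intro!: permutes_not_in[OF assms(5)])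
    then show "r \<circ> p \<in> S \<rightarrow> S" using permutes_in_image[OF assms(4)] by auto
  qed
  have T: "orbit (r \<circ> p) x = orbit r x" if "x \<in> T" for x
  proof (rule orbit_cong0[OF that])
    show "(r \<circ> p) y = r y" if "y \<in> T" for y
    proof -
      have "y \<notin> S" using that assms(3) by blast
      then show ?thesis by (simp add: permutes_not_in[OF assms(4)])
    qed
    then show "r \<circ> p \<in> T \<rightarrow> T" using permutes_in_image[OF assms(5)] by auto
  qed
  have "orbit (r \<circ> p) ` (S \<union> T) = orbit p ` S \<union> orbit r ` T"
    unfolding image_Un using S T by (simp cong: image_cong)
  moreover have "orbit p ` S \<inter> orbit r ` T = {}"
  proof (rule ccontr)
    assume "orbit p ` S \<inter> orbit r ` T \<noteq> {}"
    then obtain x y where xy: "x \<in> S" "y \<in> T" "orbit p x = orbit r y" by auto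
    have "orbit p x \<subseteq> S \<inter> T"
      using permutes_orbit_subset[OF assms(4) xy(1)] permutes_orbit_subset[OF assms(5) xy(2)] xy(3)
      by auto
    with assms(3) orbit_nonempty[of p x] show False by auto
  qed
  ultimately show ?thesis
    using assms(1,2) by (simp add: num_orbits_def card_Un_disjoint)
qed

lemma num_orbits_id: "num_orbits id S = card S"
proof -
  have "orbit id x = {x}" for x :: 'a by (simp add: orbit_eq_singleton_iff)
  then have "orbit id ` S = (\<lambda>x. {x}) ` S" by simp
  then show ?thesis by (simp add: num_orbits_def card_image)
qed

text \<open>Write \<open>g\<close> as a transposition at \<open>z\<close> after a permutation
  \<open>g'\<close> fixing \<open>z\<close>. Then \<open>g'\<close> moves only points outside
  \<open>S\<close>, commutes with \<open>q2\<close>, and orbit counts add. Restoring the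
  transposition merges two orbits, both in the product and in \<open>g\<close> alone; the 1 is the
  fixed point \<open>z\<close> of \<open>g'\<close>.\<close>

lemma num_orbits_wedge:
  assumes fin: "finite S" "finite T" and ST: "S \<inter> T = {z}"
    and q: "q1 permutes S" "q2 permutes S" and g: "g permutes T"
  shows "num_orbits (q2 \<circ> g \<circ> q1) (S \<union> T) + 1 = num_orbits (q2 \<circ> q1) S + num_orbits g T"
proof -
  define T' where "T' = T - {z}"
  define g' where "g' = transpose z (g z) \<circ> g"
  have z: "z \<in> S" "z \<in> T" using ST by auto
  have gz: "g z \<in> T" using z(2) by (simp add: permutes_in_image[OF g])
  have ST': "S \<union> T = S \<union> T'" "S \<inter> T' = {}" "T = {z} \<union> T'" "{z} \<inter> T' = {}" "finite T'"
    using ST fin by (auto simp: T'_def)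
  have "g' permutes T"
    using g z gz by (simp add: g'_def permutes_compose permutes_swap_id)
  then have g': "g' permutes T'"
    by (rule permutes_superset) (auto simp: T'_def g'_def)
  have g_eq: "g = transpose z (g z) \<circ> g'" by (simp add: g'_def comp_assoc[symmetric])
  have comm: "q2 (g' x) = g' (q2 x)" for x
  proof (cases "x \<in> S")
    case True
    then have "q2 x \<in> S" by (simp add: permutes_in_image[OF q(2)])
    with True ST'(2) have "x \<notin> T'" "q2 x \<notin> T'" by blast+
    then show ?thesis by (simp add: permutes_not_in[OF g'])
  next
    case False
    then have "g' x \<notin> S"
      using permutes_in_image[OF g', of x] permutes_not_in[OF g', of x] ST'(2) by (cases "x \<in> T'") auto
    with False show ?thesis by (simp add: permutes_not_in[OF q(2)])
  qed
  have q21: "q2 \<circ> q1 permutes S" using q by (simp add: permutes_compose)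
  let ?p = "g' \<circ> (q2 \<circ> q1)"
  have p: "?p permutes S \<union> T'"
    by (rule permutes_compose[OF permutes_subset[OF q21] permutes_subset[OF g']]) auto
  have c1: "num_orbits ?p (S \<union> T') = num_orbits (q2 \<circ> q1) S + num_orbits g' T'"
    by (rule num_orbits_disjoint[OF fin(1) ST'(5,2) q21 g'])
  have c2: "num_orbits g' T = 1 + num_orbits g' T'"
    using num_orbits_disjoint[OF _ ST'(5,4) permutes_id g'] ST'(3) num_orbits_id[of "{z}"] by simp
  show ?thesis
  proof (cases "g z = z")
    case True
    then have "g = g'" by (simp add: g'_def)
    moreover have "q2 \<circ> g' \<circ> q1 = ?p" by (simp add: fun_eq_iff comm)
    ultimately show ?thesis using c1 c2 by (simp only: ST'(1))
  next
    case False
    then have b: "g z \<in> T'" using gz by (simp add: T'_def)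
    then have "g z \<notin> S" using ST'(2) by blast
    have q2z: "q2 z \<in> S" using z(1) by (simp add: permutes_in_image[OF q(2)])
    have "inj q2" using q(2) by (rule permutes_inj)
    \<comment> \<open>Moving the transposition past \<open>q2\<close> conjugates it, and
      \<open>q2\<close> fixes \<open>g z\<close>.\<close>
    have "q2 (transpose z (g z) x) = transpose (q2 z) (g z) (q2 x)" for x
    proof -
      have "q2 (g z) = g z" using permutes_not_in[OF q(2) \<open>g z \<notin> S\<close>] .
      moreover have "q2 (transpose z (g z) x) = transpose (q2 z) (q2 (g z)) (q2 x)"
        by (simp add: transpose_def inj_eq[OF \<open>inj q2\<close>])
      ultimately show ?thesis by (simp only:)
    qed
    then have eq: "transpose (q2 z) (g z) \<circ> ?p = q2 \<circ> (transpose z (g z) \<circ> g') \<circ> q1"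
      by (simp add: fun_eq_iff comm)
    \<comment> \<open>The merged orbits are distinct: one stays in \<open>S\<close>, the other
      starts outside \<open>S\<close>.\<close>
    have "g z \<notin> orbit ?p (q2 z)"
    proof -
      have closed: "?p y \<in> S" if "y \<in> S" for y
      proof -
        have "(q2 \<circ> q1) y \<in> S" using that by (simp only: permutes_in_image[OF q21])
        moreover from this have "(q2 \<circ> q1) y \<notin> T'" using ST'(2) by blast
        ultimately show ?thesis by (simp add: permutes_not_in[OF g'])
      qed
      have "y \<in> S" if "y \<in> orbit ?p (q2 z)" for y
        using that by induction (rule closed, fact q2z, rule closed)
      with \<open>g z \<notin> S\<close> show ?thesis by blast
    qed
    then have "num_orbits ?p (S \<union> T') = num_orbits (transpose (q2 z) (g z) \<circ> ?p) (S \<union> T') + 1"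
      using fin(1) ST'(5) q2z b by (intro num_orbits_merge p) auto
    then have c3: "num_orbits ?p (S \<union> T') = num_orbits (q2 \<circ> g \<circ> q1) (S \<union> T) + 1"
      by (simp only: eq g_eq[symmetric] ST'(1))
    have "g' z = z" by (simp add: g'_def)
    then have "g z \<notin> orbit g' z" using False by (simp add: orbit_eq_singleton_iff[THEN iffD2])
    from num_orbits_merge[OF fin(2) \<open>g' permutes T\<close> z(2) gz this]
    have "num_orbits g' T = num_orbits g T + 1" by (simp only: g_eq[symmetric])
    with c1 c2 c3 show ?thesis by simp
  qed
qed

lemma num_orbits_image:
  assumes "inj e" "\<And>x. f (e x) = e (p x)"
  shows "num_orbits f (e ` S) = num_orbits p S"
proof -
  have "orbit f (e x) = e ` orbit p x" for x
  proof safe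
    fix y assume "y \<in> orbit f (e x)"
    then show "y \<in> e ` orbit p x"
      by induction (auto simp: assms(2) intro: orbit.intros)
  next
    fix y assume "y \<in> orbit p x"
    then show "e y \<in> orbit f (e x)"
      by induction (auto simp: assms(2)[symmetric] intro: orbit.intros)
  qed
  then have "orbit f ` e ` S = (`) e ` orbit p ` S" by (simp add: image_image)
  moreover have "inj ((`) e)" using assms(1) by (simp add: inj_on_def inj_image_eq_iff)
  ultimately show ?thesis by (simp add: num_orbits_def card_image inj_on_subset)
qed

section \<open>Permutations and components of stacked braids\<close>

lemma braid_perm_Nil: "braid_perm [] = id"
  by (simp add: braid_perm_def)

lemma braid_perm_append: "braid_perm (u @ v) = braid_perm v \<circ> braid_perm u"
proof -
  have "fold (\<lambda>i p. transpose i (i + 1) \<circ> p) v p = fold (\<lambda>i p. transpose i (i + 1) \<circ> p) v id \<circ> p"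
    for p :: "nat \<Rightarrow> nat"
    by (induction v rule: rev_induct) (auto simp: comp_assoc)
  then show ?thesis unfolding braid_perm_def fold_append comp_apply by blast
qed

lemma braid_perm_Cons: "braid_perm (k # w) = braid_perm w \<circ> transpose k (k + 1)"
  using braid_perm_append[of "[k]" w] by (simp add: braid_perm_def)

lemma braid_perm_permutes:
  assumes "set w \<subseteq> {a..<b}"
  shows "braid_perm w permutes {a..b}"
  using assms
proof (induction w)
  case (Cons k w)
  then have "transpose k (k + 1) permutes {a..b}" by (auto intro: permutes_swap_id)
  moreover have "braid_perm w permutes {a..b}" using Cons by simp
  ultimately show ?case unfolding braid_perm_Cons by (rule permutes_compose)
qed (simp add: braid_perm_Nil permutes_id)

lemma braid_perm_add_strands_below: "braid_perm (add_strands_below d w) (x + d) = braid_perm w x + d"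
proof (induction w arbitrary: x)
  case (Cons k w)
  have "transpose (k + d) (k + d + 1) (x + d) = transpose k (k + 1) x + d"
    by (auto simp: transpose_def)
  with Cons show ?case by (simp add: add_strands_below_def braid_perm_Cons)
qed (simp add: add_strands_below_def braid_perm_Nil)

lemma components_eq: "components n w = num_orbits (braid_perm w) {1..n}"
  by (simp add: components_def num_orbits_def)

text \<open>The wedge lemma with the two parts of the braid sharing exactly strand
  \<open>n\<close>.\<close>

lemma components_stack:
  assumes nm: "n \<ge> 1" "m \<ge> 1"
    and w: "braid_word n \<beta>1" "braid_word n \<beta>2" "braid_word m \<gamma>"
  shows "components (n + m - 1) (\<beta>1 @ add_strands_below (n - 1) \<gamma> @ \<beta>2) + 1 =
    components m \<gamma> + components n (\<beta>1 @ \<beta>2)"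
proof -
  let ?\<gamma> = "add_strands_below (n - 1) \<gamma>" and ?T = "{n..n + m - 1}"
  have "set ?\<gamma> \<subseteq> {n..<n + m - 1}"
    using w(3) nm unfolding add_strands_below_def braid_word_def by fastforce
  then have g: "braid_perm ?\<gamma> permutes ?T" by (rule braid_perm_permutes)
  have q: "braid_perm \<beta>1 permutes {1..n}" "braid_perm \<beta>2 permutes {1..n}"
    using w(1,2) by (auto simp: braid_word_def intro: braid_perm_permutes)
  have "1 + (n - 1) = n" "m + (n - 1) = n + m - 1" using nm by auto
  then have "(\<lambda>i. i + (n - 1)) ` {1..m} = ?T"
    by (simp only: image_add_atLeastAtMost')
  moreover have "num_orbits (braid_perm ?\<gamma>) ((\<lambda>i. i + (n - 1)) ` {1..m}) = components m \<gamma>"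
    unfolding components_eq
    by (rule num_orbits_image) (auto simp: inj_def braid_perm_add_strands_below)
  ultimately have "num_orbits (braid_perm ?\<gamma>) ?T = components m \<gamma>" by (simp only:)
  moreover have "{1..n} \<union> ?T = {1..n + m - 1}" "{1..n} \<inter> ?T = {n}" using nm by auto
  ultimately show ?thesis
    using num_orbits_wedge[OF _ _ _ q g, of n]
    by (simp add: components_eq braid_perm_append comp_assoc)
qed


section \<open>Log-concavity of products\<close>

unbundle fps_syntax

text \<open>
  For nonnegative sequences, log-concavity without internal zeros amounts to nonnegativity of all \<open>2 \<times> 2\<close> minors
  of the Toeplitz matrix. The minors of a convolution are given by the Cauchy--Binet formula.
\<close>

definition log_concave_int :: "(int \<Rightarrow> real) \<Rightarrow> bool" where
  "log_concave_int a \<longleftrightarrow> (\<forall>i. 0 \<le> a i) \<and>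
     (\<forall>p q s t. s \<le> p \<and> s \<le> q \<and> p + q = s + t \<longrightarrow> a s * a t \<le> a p * a q)"

text \<open>The sum over all ordered pairs meets each pair of columns twice, hence the factor 2; no
  order on the index type is involved. The proof adds the expansion of the determinant to itself
  with \<open>i\<close> and \<open>j\<close> exchanged.\<close>

lemma cauchy_binet_2:
  fixes x y u v :: "'i \<Rightarrow> real"
  shows "2 * ((\<Sum>i\<in>I. x i * u i) * (\<Sum>i\<in>I. y i * v i) - (\<Sum>i\<in>I. x i * v i) * (\<Sum>i\<in>I. y i * u i)) =
    (\<Sum>i\<in>I. \<Sum>j\<in>I. (x i * y j - x j * y i) * (u i * v j - v i * u j))" (is "2 * ?d = ?s")
proof -
  have e1: "?d = (\<Sum>i\<in>I. \<Sum>j\<in>I. x i * y j * (u i * v j - v i * u j))"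
    by (simp only: sum_product sum_subtractf[symmetric]) (simp add: algebra_simps)
  have e2: "?d = (\<Sum>i\<in>I. \<Sum>j\<in>I. - (x j * y i * (u i * v j - v i * u j)))"
    by (subst e1, subst sum.swap) (simp add: algebra_simps)
  have "2 * ?d = (\<Sum>i\<in>I. \<Sum>j\<in>I. x i * y j * (u i * v j - v i * u j)) +
      (\<Sum>i\<in>I. \<Sum>j\<in>I. - (x j * y i * (u i * v j - v i * u j)))"
    unfolding mult_2 by (rule arg_cong2[where f = "(+)", OF e1 e2])
  also have "\<dots> = ?s"
    by (simp add: sum.distrib[symmetric] algebra_simps)
  finally show ?thesis .
qed

text \<open>The minor of the convolution for \<open>p, q, s, t\<close> is a sum of products of a
  minor of \<open>a\<close> and a minor of \<open>b\<close>. Both are nonnegative for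
  \<open>i \<le> j\<close> and nonpositive otherwise, so every product is nonnegative.\<close>

lemma log_concave_int_convolution:
  assumes a: "log_concave_int a" "\<And>i. i < 0 \<Longrightarrow> a i = 0"
    and b: "log_concave_int b" "\<And>i. i < 0 \<Longrightarrow> b i = 0"
  shows "log_concave_int (\<lambda>k. \<Sum>i=0..k. b i * a (k - i))" (is "log_concave_int ?c")
proof -
  have "?c s * ?c t \<le> ?c p * ?c q" if st: "s \<le> p" "s \<le> q" "p + q = s + t" for p q s t
  proof -
    define I where "I = {0..t}"
    define d where "d = p - s"
    have d: "0 \<le> d" "p \<le> t" "q = t - d" "s = p - d" using st by (auto simp: d_def)
    \<comment> \<open>A common index range and the shift \<open>d = p - s = t - q\<close> make the
      four convolutions entries of one matrix product.\<close>
    have c: "?c k = (\<Sum>i\<in>I. a (k - i) * b i)" "?c (k - d) = (\<Sum>i\<in>I. a (k - i) * b (i - d))"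
      if "k \<le> t" for k
    proof -
      show "?c k = (\<Sum>i\<in>I. a (k - i) * b i)"
        unfolding I_def using that a(2) by (intro sum.mono_neutral_cong_left) auto
      have "?c (k - d) = (\<Sum>i\<in>{d..k}. a (k - i) * b (i - d))"
        by (rule sum.reindex_bij_witness[of _ "\<lambda>i. i - d" "\<lambda>i. i + d"]) (auto simp: algebra_simps)
      also have "\<dots> = (\<Sum>i\<in>I. a (k - i) * b (i - d))"
        unfolding I_def using that a(2) b(2) d(1) by (intro sum.mono_neutral_cong_left) auto
      finally show "?c (k - d) = (\<Sum>i\<in>I. a (k - i) * b (i - d))" .
    qed
    have minor: "0 \<le> (a (p - i) * a (t - j) - a (p - j) * a (t - i)) * (b i * b (j - d) - b (i - d) * b j)"
      for i j
    proof (cases "i \<le> j")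
      case True
      then have "a (p - j) * a (t - i) \<le> a (p - i) * a (t - j)" "b (i - d) * b j \<le> b i * b (j - d)"
        using a(1) b(1) d by (auto simp: log_concave_int_def)
      then show ?thesis by simp
    next
      case False
      then have "a (p - i) * a (t - j) \<le> a (p - j) * a (t - i)" "b (j - d) * b i \<le> b j * b (i - d)"
        using a(1) b(1) d by (auto simp: log_concave_int_def)
      then show ?thesis by (intro mult_nonpos_nonpos) (simp_all add: mult.commute)
    qed
    have "0 \<le> (\<Sum>i\<in>I. \<Sum>j\<in>I. (a (p - i) * a (t - j) - a (p - j) * a (t - i)) * (b i * b (j - d) - b (i - d) * b j))"
      by (intro sum_nonneg minor)
    also have "\<dots> = 2 * ((\<Sum>i\<in>I. a (p - i) * b i) * (\<Sum>i\<in>I. a (t - i) * b (i - d)) -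
        (\<Sum>i\<in>I. a (p - i) * b (i - d)) * (\<Sum>i\<in>I. a (t - i) * b i))"
      by (rule cauchy_binet_2[symmetric])
    also have "\<dots> = 2 * (?c p * ?c q - ?c s * ?c t)"
      unfolding d(3,4) c[OF d(2)] c[OF order_refl] ..
    finally show ?thesis by simp
  qed
  moreover have "0 \<le> ?c k" for k
    using a(1) b(1) by (auto simp: log_concave_int_def intro!: sum_nonneg)
  ultimately show ?thesis by (simp only: log_concave_int_def) blast
qed


text \<open>Multiplying adjacent inequalities and cancelling the inner terms, positive since there
  are no internal zeros, gives the outward step by one from any \<open>p \<le> q\<close>; iterating
  it gives all minors.\<close>

lemma log_concave_intI:
  assumes nonneg: "\<And>i. 0 \<le> a i"
    and lc: "\<And>j. a (j - 1) * a (j + 1) \<le> (a j)\<^sup>2"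
    and niz: "\<And>i j k. i < j \<Longrightarrow> j < k \<Longrightarrow> 0 < a i \<Longrightarrow> 0 < a k \<Longrightarrow> a j \<noteq> 0"
  shows "log_concave_int a"
proof -
  have step: "a (p - 1) * a (q + 1) \<le> a p * a q" if "p \<le> q" for p q
    using that
  proof (induction q rule: int_ge_induct)
    case base
    then show ?case using lc[of p] by (simp add: power2_eq_square)
  next
    case (step q)
    show ?case
    proof (cases "0 < a (p - 1) \<and> 0 < a (q + 1 + 1)")
      case True
      then have pos: "0 < a q" "0 < a (q + 1)"
        using niz[of "p - 1" q "q + 1 + 1"] niz[of "p - 1" "q + 1" "q + 1 + 1"] step.hyps
          nonneg[of q] nonneg[of "q + 1"] by auto
      have "(a q * a (q + 1)) * (a (p - 1) * a (q + 1 + 1)) =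
          (a (p - 1) * a (q + 1)) * (a q * a (q + 1 + 1))"
        by simp
      also have "\<dots> \<le> (a p * a q) * (a (q + 1))\<^sup>2"
        using step.IH lc[of "q + 1"] by (intro mult_mono[OF step.IH]) (simp_all add: nonneg)
      also have "\<dots> = (a q * a (q + 1)) * (a p * a (q + 1))"
        by (simp add: power2_eq_square)
      finally show ?thesis using pos by (simp add: mult_le_cancel_left_pos)
    next
      case False
      then have "a (p - 1) = 0 \<or> a (q + 1 + 1) = 0"
        using nonneg[of "p - 1"] nonneg[of "q + 1 + 1"] by auto
      then show ?thesis by (auto simp: nonneg)
    qed
  qed
  have spread: "a (p - int e) * a (q + int e) \<le> a p * a q" if "p \<le> q" for p q e
  proof (induction e)
    case (Suc e)
    have "a (p - int (Suc e)) * a (q + int (Suc e)) \<le> a (p - int e) * a (q + int e)"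
      using step[of "p - int e" "q + int e"] that by (simp add: algebra_simps)
    with Suc show ?case by linarith
  qed simp
  have "a s * a t \<le> a p * a q" if "s \<le> p" "s \<le> q" "p + q = s + t" for p q s t
  proof (cases "p \<le> q")
    case True
    have "p - int (nat (p - s)) = s" "q + int (nat (p - s)) = t" using that by auto
    with spread[OF True, of "nat (p - s)"] show ?thesis by (simp only:)
  next
    case False
    have "q - int (nat (q - s)) = s" "p + int (nat (q - s)) = t" using that by auto
    with spread[of q p "nat (q - s)"] False show ?thesis by (simp only: mult.commute linear not_le less_imp_le)
  qed
  then show ?thesis using nonneg by (simp add: log_concave_int_def)
qed

text \<open>The inequality for neighbours carries positivity from both ends inwards until
  \<open>j\<close> is reached.\<close>

lemma log_concave_int_pos_between:
  assumes a: "log_concave_int a" and "i < j" "j < k" "0 < a i" "0 < a k"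
  shows "0 < a j"
  using assms(2-)
proof (induction "nat (k - i)" arbitrary: i k rule: less_induct)
  case less
  have nonneg: "0 \<le> a l" for l using a by (simp add: log_concave_int_def)
  have "a i * a k \<le> a (i + 1) * a (k - 1)"
    using a less.prems by (simp add: log_concave_int_def)
  moreover have "0 < a i * a k" using less.prems by simp
  ultimately have "0 < a (i + 1) * a (k - 1)" by linarith
  then have "0 < a (i + 1)" "0 < a (k - 1)"
    using nonneg[of "i + 1"] nonneg[of "k - 1"] by (auto simp: zero_less_mult_iff)
  then show ?case
    using less.hyps[of "k - 1" "i + 1"] less.prems
    by (cases "j = i + 1"; cases "j = k - 1") auto
qed

section \<open>Coefficient sequences of polynomials in z^2\<close>

definition even_poly :: "int fls \<Rightarrow> bool" where
  "even_poly P \<longleftrightarrow> finite {k. P $$ k \<noteq> 0} \<and> (\<forall>k. P $$ k \<noteq> 0 \<longrightarrow> 0 \<le> k \<and> even k)"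

text \<open>The sequence is extended by zero to all integers. The bound by
  \<open>half_degree\<close> is invoked only at nonzero coefficients, so the zero polynomial, where
  \<open>Max\<close> is taken of the empty set, causes no trouble.\<close>

lemma log_concave_coeffs_iff:
  assumes "even_poly P"
  shows "log_concave_coeffs P \<longleftrightarrow> log_concave_int (\<lambda>i. real_of_int (P $$ (2 * i)))"
proof
  let ?a = "\<lambda>i. real_of_int (P $$ (2 * i))"
  assume *: "log_concave_coeffs P"
  have small: "0 \<le> i" if "?a i \<noteq> 0" for i
    using assms that by (force simp: even_poly_def)
  have big: "i \<le> int (half_degree P)" if "?a i \<noteq> 0" for i
  proof -
    have "2 * i \<le> Max {k. P $$ k \<noteq> 0}"
      using that assms by (intro Max_ge) (auto simp: even_poly_def)
    then show ?thesis unfolding half_degree_def by linarith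
  qed
  have ec: "?a i = even_coeff P (nat i)" if "0 \<le> i" for i
    using that by (simp add: even_coeff_def)
  show "log_concave_int ?a"
  proof (rule log_concave_intI)
    show "0 \<le> ?a i" for i
    proof (cases "?a i = 0")
      case False
      then have "0 \<le> i" "nat i \<le> half_degree P" using small[of i] big[of i] by auto
      then show ?thesis
        unfolding ec[OF \<open>0 \<le> i\<close>] using * by (simp add: log_concave_coeffs_def log_concave_def)
    qed simp
  next
    show "?a (j - 1) * ?a (j + 1) \<le> (?a j)\<^sup>2" for j
    proof (cases "?a (j - 1) = 0 \<or> ?a (j + 1) = 0")
      case False
      then have j: "1 \<le> j" "j + 1 \<le> int (half_degree P)"
        using small[of "j - 1"] big[of "j + 1"] by auto
      then have "even_coeff P (nat j - 1) * even_coeff P (nat j + 1) \<le> (even_coeff P (nat j))\<^sup>2"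
      proof -
        have "1 \<le> nat j" "nat j + 1 \<le> half_degree P" using j by linarith+
        with * show ?thesis unfolding log_concave_coeffs_def log_concave_def by blast
      qed
      moreover have "nat j - 1 = nat (j - 1)" "nat j + 1 = nat (j + 1)" using j by auto
      ultimately show ?thesis using j by (simp only: ec)
    qed auto
  next
    fix i j k assume ijk: "i < j" "j < k" "0 < ?a i" "0 < ?a k"
    then have ik: "0 \<le> i" "k \<le> int (half_degree P)" using small[of i] big[of k] by auto
    then have "nat i < nat j" "nat j < nat k" "nat k \<le> half_degree P" using ijk by auto
    moreover have "0 < even_coeff P (nat i)" "0 < even_coeff P (nat k)"
      using ijk ik by (simp_all only: ec)
    ultimately have nz: "even_coeff P (nat j) \<noteq> 0"
      using * unfolding log_concave_coeffs_def no_internal_zeros_def by blast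
    have "0 \<le> j" using ijk ik by linarith
    show "?a j \<noteq> 0" unfolding ec[OF \<open>0 \<le> j\<close>] by (rule nz)
  qed
next
  assume *: "log_concave_int (\<lambda>i. real_of_int (P $$ (2 * i)))"
  have "even_coeff P (j - 1) * even_coeff P (j + 1) \<le> (even_coeff P j)\<^sup>2" if "1 \<le> j" for j
  proof -
    have "real_of_int (P $$ (2 * (int j - 1))) * real_of_int (P $$ (2 * (int j + 1))) \<le>
        real_of_int (P $$ (2 * int j)) * real_of_int (P $$ (2 * int j))"
      using *[unfolded log_concave_int_def, THEN conjunct2, rule_format,
          of "int j - 1" "int j" "int j" "int j + 1"] by simp
    moreover have "int (j - 1) = int j - 1" "int (j + 1) = int j + 1" using that by auto
    ultimately show ?thesis by (simp only: even_coeff_def power2_eq_square)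
  qed
  moreover have "even_coeff P j \<noteq> 0" if "i < j" "j < k" "0 < even_coeff P i" "0 < even_coeff P k"
    for i j k
    using log_concave_int_pos_between[OF *, of "int i" "int j" "int k"] that
    by (auto simp: even_coeff_def)
  moreover have "0 \<le> even_coeff P j" for j
    using * unfolding log_concave_int_def even_coeff_def by blast
  ultimately show "log_concave_coeffs P"
    unfolding log_concave_coeffs_def log_concave_def no_internal_zeros_def by blast
qed

lemma even_poly_times_nth:
  assumes "even_poly P" "even_poly Q"
  shows "(P * Q) $$ (2 * k) = (\<Sum>i=0..k. P $$ (2 * i) * Q $$ (2 * (k - i)))"
proof -
  have sub: "0 \<le> fls_subdegree F" if "even_poly F" for F
    using that nth_fls_subdegree_nonzero[of F] by (cases "F = 0") (auto simp: even_poly_def)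
  have "(P * Q) $$ (2 * k) =
      (\<Sum>i=fls_subdegree P..2 * k - fls_subdegree Q. P $$ i * Q $$ (2 * k - i))"
    by (rule fls_times_nth)
  also have "\<dots> = (\<Sum>i=0..2 * k. P $$ i * Q $$ (2 * k - i))"
    using sub[OF assms(1)] sub[OF assms(2)] by (intro sum.mono_neutral_left) auto
  also have "\<dots> = (\<Sum>i\<in>(*) 2 ` {0..k}. P $$ i * Q $$ (2 * k - i))"
  proof (rule sum.mono_neutral_right)
    show "\<forall>i\<in>{0..2 * k} - (*) 2 ` {0..k}. P $$ i * Q $$ (2 * k - i) = 0"
    proof
      fix i assume i: "i \<in> {0..2 * k} - (*) 2 ` {0..k}"
      then have "odd i" by (auto elim!: evenE)
      then have "P $$ i = 0" using assms(1) by (auto simp: even_poly_def)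
      then show "P $$ i * Q $$ (2 * k - i) = 0" by simp
    qed
  qed auto
  also have "\<dots> = (\<Sum>i=0..k. P $$ (2 * i) * Q $$ (2 * (k - i)))"
    by (subst sum.reindex) (auto simp: inj_on_def algebra_simps)
  finally show ?thesis .
qed

lemma log_concave_coeffs_mult:
  assumes P: "even_poly P" "log_concave_coeffs P" and Q: "even_poly Q" "log_concave_coeffs Q"
    and "even_poly (P * Q)"
  shows "log_concave_coeffs (P * Q)"
proof -
  have neg: "real_of_int (F $$ (2 * i)) = 0" if "even_poly F" "i < 0" for F i
    using that by (force simp: even_poly_def)
  show ?thesis
    using log_concave_int_convolution[OF log_concave_coeffs_iff[OF Q(1), THEN iffD1, OF Q(2)]
        neg[OF Q(1)] log_concave_coeffs_iff[OF P(1), THEN iffD1, OF P(2)] neg[OF P(1)]]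
    by (simp add: log_concave_coeffs_iff[OF assms(5)] even_poly_times_nth[OF P(1) Q(1)])
qed


section \<open>Parity of the normalized ruling polynomial\<close>

text \<open>A nonzero coefficient at \<open>s\<close> comes from a walk with \<open>s\<close>
  switches, and \<open>B\<close> is the permutation of the word with the switched letters deleted.
  Each deletion changes the number of orbits by one, which yields the bound and the parity. The free
  \<open>q\<close> absorbs the letters already read; the bound by the length gives finite
  support.\<close>

lemma walk_sum_coeff:
  assumes "braid_word n w" "walk_sum w g (\<lambda>f. of_bool (f = h)) $$ s \<noteq> 0"
  shows "s \<le> int (length w) \<and> (\<exists>B. B permutes {1..n} \<and> h \<circ> B = g \<and>
    (\<forall>q. q permutes {1..n} \<longrightarrow>
       \<bar>int (num_orbits (braid_perm w \<circ> q) {1..n}) - int (num_orbits (B \<circ> q) {1..n})\<bar> \<le> s \<and>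
       even (int (num_orbits (braid_perm w \<circ> q) {1..n}) - int (num_orbits (B \<circ> q) {1..n}) - s)))"
    (is "_ \<and> ?E w g s")
  using assms
proof (induction w arbitrary: g s)
  case Nil
  then have "g = h" "s = 0" by (cases "g = h"; auto split: if_splits)+
  then show ?case
    by (auto simp: braid_perm_Nil intro!: exI[of _ id] permutes_id)
next
  case (Cons k w)
  let ?t = "transpose k (k + 1)" and ?c = "\<lambda>p. int (num_orbits p {1..n})"
  have k: "k \<in> {1..n}" "k + 1 \<in> {1..n}" and w: "braid_word n w"
    using Cons.prems(1) by (auto simp: braid_word_def)
  have t: "?t permutes {1..n}" using k by (simp add: permutes_swap_id)
  have "walk_sum w (g \<circ> ?t) (\<lambda>f. of_bool (f = h)) $$ s \<noteq> 0 \<or>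
      walk_sum w g (\<lambda>f. of_bool (f = h)) $$ (s - 1) \<noteq> 0"
    by (rule ccontr)
      (use Cons.prems(2) in \<open>auto simp: fls_X_times_conv_shift split: if_splits\<close>)
  then consider (move) "walk_sum w (g \<circ> ?t) (\<lambda>f. of_bool (f = h)) $$ s \<noteq> 0"
    | (stay) "walk_sum w g (\<lambda>f. of_bool (f = h)) $$ (s - 1) \<noteq> 0"
    by blast
  then show ?case
  proof cases
    case move
    from Cons.IH[OF w move] obtain B where B: "s \<le> int (length w)" "B permutes {1..n}" "h \<circ> B = g \<circ> ?t"
      and cnt: "\<And>q. q permutes {1..n} \<Longrightarrow> \<bar>?c (braid_perm w \<circ> q) - ?c (B \<circ> q)\<bar> \<le> s \<and>
        even (?c (braid_perm w \<circ> q) - ?c (B \<circ> q) - s)"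
      by blast
    have "B \<circ> ?t permutes {1..n}" by (rule permutes_compose[OF t B(2)])
    moreover have "h \<circ> (B \<circ> ?t) = g"
      by (simp only: comp_assoc[symmetric] B(3)) (simp add: comp_assoc)
    moreover have "\<bar>?c (braid_perm (k # w) \<circ> q) - ?c (B \<circ> ?t \<circ> q)\<bar> \<le> s \<and>
        even (?c (braid_perm (k # w) \<circ> q) - ?c (B \<circ> ?t \<circ> q) - s)" if "q permutes {1..n}" for q
      unfolding braid_perm_Cons comp_assoc by (rule cnt[OF permutes_compose[OF that t]])
    ultimately have "?E (k # w) g s" by blast
    with B(1) show ?thesis by simp
  next
    case stay
    from Cons.IH[OF w stay] obtain B where B: "s - 1 \<le> int (length w)" "B permutes {1..n}" "h \<circ> B = g"
      and cnt: "\<And>q. q permutes {1..n} \<Longrightarrow> \<bar>?c (braid_perm w \<circ> q) - ?c (B \<circ> q)\<bar> \<le> s - 1 \<and>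
        even (?c (braid_perm w \<circ> q) - ?c (B \<circ> q) - (s - 1))"
      by blast
    have "\<bar>?c (braid_perm (k # w) \<circ> q) - ?c (B \<circ> q)\<bar> \<le> s \<and>
        even (?c (braid_perm (k # w) \<circ> q) - ?c (B \<circ> q) - s)" if q: "q permutes {1..n}" for q
    proof -
      have "inj B" using B(2) by (rule permutes_inj)
      \<comment> \<open>Conjugation by \<open>B\<close> turns the deleted letter into a
        transposition on the left, as \<open>num_orbits_swap\<close> requires.\<close>
      then have "B \<circ> (?t \<circ> q) = transpose (B k) (B (k + 1)) \<circ> (B \<circ> q)"
        by (auto simp: fun_eq_iff transpose_def inj_eq)
      moreover have "\<bar>?c (transpose (B k) (B (k + 1)) \<circ> (B \<circ> q)) - ?c (B \<circ> q)\<bar> = 1"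
        using k \<open>inj B\<close> permutes_in_image[OF B(2)]
        by (intro num_orbits_swap permutes_compose[OF q B(2)]) (auto simp: inj_eq)
      ultimately have swap: "\<bar>?c (B \<circ> (?t \<circ> q)) - ?c (B \<circ> q)\<bar> = 1" by simp
      have "\<bar>?c (braid_perm (k # w) \<circ> q) - ?c (B \<circ> (?t \<circ> q))\<bar> \<le> s - 1 \<and>
        even (?c (braid_perm (k # w) \<circ> q) - ?c (B \<circ> (?t \<circ> q)) - (s - 1))"
        unfolding braid_perm_Cons comp_assoc by (rule cnt[OF permutes_compose[OF q t]])
      with swap show ?thesis by presburger
    qed
    with B(2,3) have "?E (k # w) g s" by blast
    with B(1) show ?thesis by simp
  qed
qed

lemma normalized_ruling_poly_eq:
  assumes "braid_word n w"
  shows "normalized_ruling_poly n w = fls_X_intpow (int (components n w) - int n) * closed_walk_sum n w"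
  unfolding normalized_ruling_poly_def ruling_poly_rainbow[OF assms]
  by (simp only: mult.assoc[symmetric] fls_X_intpow_times_fls_X_intpow) simp

text \<open>For a closed walk \<open>B\<close> fixes the injective initial heights, so it is the
  identity, with \<open>n\<close> orbits. With \<open>c\<close> components and \<open>s\<close>
  switches the exponent is \<open>s + c - n\<close>; it is even and nonnegative since
  \<open>s\<close> bounds \<open>c - n\<close> in absolute value and has its parity.\<close>

lemma even_poly_normalized_ruling_poly:
  assumes w: "braid_word n w"
  shows "even_poly (normalized_ruling_poly n w)"
proof -
  let ?h = "to_arcs n (nested n)" and ?c = "int (components n w)"
  have coeff: "k \<le> int (length w) + ?c \<and> 0 \<le> k \<and> even k" if k: "normalized_ruling_poly n w $$ k \<noteq> 0" for k
  proof -
    have "closed_walk_sum n w $$ (k - ?c + int n) \<noteq> 0"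
      using k unfolding normalized_ruling_poly_eq[OF w] fls_X_intpow_times_conv_shift
      by (simp add: algebra_simps)
    from walk_sum_coeff[OF w this] obtain B where
      len: "k - ?c + int n \<le> int (length w)" and B: "B permutes {1..n}" "?h \<circ> B = ?h" and
      cnt: "\<And>q. q permutes {1..n} \<Longrightarrow>
        \<bar>int (num_orbits (braid_perm w \<circ> q) {1..n}) - int (num_orbits (B \<circ> q) {1..n})\<bar> \<le> k - ?c + int n \<and>
        even (int (num_orbits (braid_perm w \<circ> q) {1..n}) - int (num_orbits (B \<circ> q) {1..n}) - (k - ?c + int n))"
      by blast
    have "inj_on ?h {1..n}" by (auto simp: nested_low inj_on_def)
    have "B = id"
    proof
      fix i show "B i = id i"
      proof (cases "i \<in> {1..n}")
        case True
        then have "B i \<in> {1..n}" using permutes_in_image[OF B(1)] by metis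
        with True \<open>inj_on ?h {1..n}\<close> fun_cong[OF B(2), of i] show ?thesis by (auto dest: inj_onD)
      qed (simp add: permutes_not_in[OF B(1)])
    qed
    then show ?thesis
      using cnt[OF permutes_id] len unfolding components_eq by (simp add: num_orbits_id) presburger
  qed
  then have "{k. normalized_ruling_poly n w $$ k \<noteq> 0} \<subseteq> {0..int (length w) + ?c}" by auto
  then show ?thesis
    unfolding even_poly_def using coeff by (blast intro: finite_subset finite_atLeastAtMost_int)
qed

theorem proposition5p6:
  fixes n m :: nat and \<beta>1 \<beta>2 \<gamma> :: "nat list"
  assumes "n \<ge> 1" and "m \<ge> 1"
    and "braid_word n \<beta>1" and "braid_word n \<beta>2" and "braid_word m \<gamma>"
  shows "ruling_poly (rainbow (n + m - 1) (\<beta>1 @ add_strands_below (n - 1) \<gamma> @ \<beta>2)) =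
           fls_X * ruling_poly (rainbow m \<gamma>) * ruling_poly (rainbow n (\<beta>1 @ \<beta>2)) \<and>
         (log_concave_coeffs (normalized_ruling_poly m \<gamma>) \<and>
          log_concave_coeffs (normalized_ruling_poly n (\<beta>1 @ \<beta>2)) \<longrightarrow>
          log_concave_coeffs
            (normalized_ruling_poly (n + m - 1) (\<beta>1 @ add_strands_below (n - 1) \<gamma> @ \<beta>2)))"
proof -
  let ?w = "\<beta>1 @ add_strands_below (n - 1) \<gamma> @ \<beta>2"
  have w: "braid_word n (\<beta>1 @ \<beta>2)" "braid_word (n + m - 1) ?w"
    using assms by (fastforce simp: braid_word_def add_strands_below_def)+
  \<comment> \<open>The extra z in the product formula compensates the component lost by sharing
    strand \<open>n\<close>, so the normalized polynomials multiply exactly.\<close>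
  have "fls_X_intpow (int (components (n + m - 1) ?w)) * (fls_X :: int fls) =
      fls_X_intpow (int (components m \<gamma>)) * fls_X_intpow (int (components n (\<beta>1 @ \<beta>2)))"
  proof -
    have "int (components (n + m - 1) ?w) + 1 = int (components m \<gamma>) + int (components n (\<beta>1 @ \<beta>2))"
      using components_stack[OF assms] by linarith
    then show ?thesis
      by (simp only: fls_X_conv_shift_1 fls_X_intpow_times_fls_X_intpow)
  qed
  then have "normalized_ruling_poly (n + m - 1) ?w =
      normalized_ruling_poly m \<gamma> * normalized_ruling_poly n (\<beta>1 @ \<beta>2)"
    unfolding normalized_ruling_poly_def ruling_poly_stack[OF assms]
    by (simp only: mult.assoc[symmetric]) (simp only: mult_ac)
  moreover note even_poly_normalized_ruling_poly[OF assms(5)]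
    even_poly_normalized_ruling_poly[OF w(1)] even_poly_normalized_ruling_poly[OF w(2)]
  ultimately show ?thesis
    using ruling_poly_stack[OF assms] log_concave_coeffs_mult by metis
qed

end
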